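(* Let $B_3=\langle\sigma_1,\sigma_2\mid\sigma_1\sigma_2\sigma_1=\sigma_2\sigma_1\sigma_2\rangle$ be the braid group on three strings. There are countably infinitely many isolated left orders in $LO(B_3)$ none of which is an automorphic image of another one of them.
   Context: A left order $\lambda$ on a countable group $G$ is a total order $<_\lambda$ with $f<_\lambda g\Rightarrow hf<_\lambda hg$ for all $f,g,h\in G$; it is identified with the map $\lambda:G\setminus\{e\}\to\{\pm1\}$, $\lambda(g)=1$ iff $g>_\lambda e$. The set $LO(G)$ of left orders is a closed subset of $\{\pm1\}^{G\setminus\{e\}}$ with the topology of pointwise convergence; $\lambda$ is isolated if it is an isolated point of $LO(G)$. Given $\phi\in\mathrm{Aut}(G)$ and $\lambda\in LO(G)$, the left order $\phi^*\lambda$ defined by $g<_{\phi^*\lambda}g'$ iff $\phi(g)<_\lambda\phi(g')$ is called an automorphic image of $\lambda$. *)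

theory Defs
  imports "HOL-Analysis.Function_Topology" "HOL-Algebra.Bij"
begin

section \<open>Groups given by generators and relations\<close>

text \<open>The letter \<open>(s, True)\<close> stands for the generator \<open>s\<close>, and \<open>(s, False)\<close> for its inverse.
  The group presented by the pairs of words \<open>R\<close> consists of all words modulo the smallest
  congruence that cancels adjacent inverse letters and identifies \<open>u\<close> with \<open>v\<close> for
  \<open>(u, v) \<in> R\<close>; all elements of the type \<open>'s\<close> are generators.\<close>

type_synonym 's word = "('s \<times> bool) list"

inductive word_eq :: "('s word \<times> 's word) set \<Rightarrow> 's word \<Rightarrow> 's word \<Rightarrow> bool"
  for R :: "('s word \<times> 's word) set" where
  refl: "word_eq R u u"
| sym: "word_eq R u v \<Longrightarrow> word_eq R v u"
| trans: "word_eq R u v \<Longrightarrow> word_eq R v w \<Longrightarrow> word_eq R u w"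
| cong: "word_eq R u u' \<Longrightarrow> word_eq R v v' \<Longrightarrow> word_eq R (u @ v) (u' @ v')"
| cancel: "word_eq R [(s, b), (s, \<not> b)] []"
| relation: "(u, v) \<in> R \<Longrightarrow> word_eq R u v"

definition word_class :: "('s word \<times> 's word) set \<Rightarrow> 's word \<Rightarrow> 's word set" where
  "word_class R u = {v. word_eq R u v}"

definition presented_group :: "('s word \<times> 's word) set \<Rightarrow> 's word set monoid" where
  "presented_group R =
     \<lparr>carrier = range (word_class R),
      monoid.mult = (\<lambda>X Y. {w. \<exists>u\<in>X. \<exists>v\<in>Y. word_eq R (u @ v) w}),
      one = word_class R []\<rparr>"

lemma word_class_eq_iff: "word_class R u = word_class R v \<longleftrightarrow> word_eq R u v"
  unfolding word_class_def
  by (auto intro: word_eq.refl word_eq.sym word_eq.trans)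

lemma carrier_presented_group: "carrier (presented_group R) = range (word_class R)"
  by (simp add: presented_group_def)

lemma one_presented_group: "\<one>\<^bsub>presented_group R\<^esub> = word_class R []"
  by (simp add: presented_group_def)

lemma mult_presented_group:
  "word_class R u \<otimes>\<^bsub>presented_group R\<^esub> word_class R v = word_class R (u @ v)"
  unfolding presented_group_def word_class_def
  by (auto intro: word_eq.refl word_eq.trans word_eq.cong)

definition inv_word :: "'s word \<Rightarrow> 's word" where
  "inv_word u = rev (map (\<lambda>(s, b). (s, \<not> b)) u)"

lemma word_eq_inv_word: "word_eq R (inv_word u @ u) []"
proof (induction u)
  case Nil
  show ?case by (simp add: inv_word_def word_eq.refl)
next
  case (Cons x u)
  obtain s b where x: "x = (s, b)" by force
  have "word_eq R [(s, \<not> b), (s, b)] []"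
    using word_eq.cancel[of R s "\<not> b"] by simp
  then have "word_eq R ([(s, \<not> b), (s, b)] @ u) ([] @ u)"
    by (rule word_eq.cong[OF _ word_eq.refl])
  then have "word_eq R (inv_word u @ ([(s, \<not> b), (s, b)] @ u)) (inv_word u @ ([] @ u))"
    by (rule word_eq.cong[OF word_eq.refl])
  then have "word_eq R (inv_word (x # u) @ x # u) (inv_word u @ u)"
    by (simp add: x inv_word_def)
  then show ?case using Cons.IH by (rule word_eq.trans)
qed

lemma group_presented_group: "group (presented_group R)"
proof (rule groupI)
  fix x assume "x \<in> carrier (presented_group R)"
  then obtain u where u: "x = word_class R u" by (auto simp: carrier_presented_group)
  have "word_class R (inv_word u) \<otimes>\<^bsub>presented_group R\<^esub> x = \<one>\<^bsub>presented_group R\<^esub>"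
    by (simp add: u mult_presented_group one_presented_group word_class_eq_iff word_eq_inv_word)
  then show "\<exists>y\<in>carrier (presented_group R). y \<otimes>\<^bsub>presented_group R\<^esub> x = \<one>\<^bsub>presented_group R\<^esub>"
    by (auto simp: carrier_presented_group)
qed (auto simp: carrier_presented_group mult_presented_group one_presented_group)

fun eval_word :: "('b, 'c) monoid_scheme \<Rightarrow> ('s \<Rightarrow> 'b) \<Rightarrow> 's word \<Rightarrow> 'b" where
  "eval_word H f [] = \<one>\<^bsub>H\<^esub>"
| "eval_word H f ((s, b) # u) = (if b then f s else inv\<^bsub>H\<^esub> f s) \<otimes>\<^bsub>H\<^esub> eval_word H f u"

lemma eval_word_closed:
  assumes "group H" "range f \<subseteq> carrier H"
  shows "eval_word H f u \<in> carrier H"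
proof -
  interpret group H by fact
  have c: "f s \<in> carrier H" for s using assms(2) by auto
  show ?thesis by (induction u) (auto simp: c)
qed

lemma eval_word_append:
  assumes "group H" "range f \<subseteq> carrier H"
  shows "eval_word H f (u @ v) = eval_word H f u \<otimes>\<^bsub>H\<^esub> eval_word H f v"
proof -
  interpret group H by fact
  have c: "f s \<in> carrier H" for s using assms(2) by auto
  note e = eval_word_closed[OF assms]
  show ?thesis by (induction u) (auto simp: e c m_assoc)
qed

text \<open>Universal property of the presentation.\<close>

lemma presented_group_hom:
  fixes H (structure)
  assumes H: "group H" and f: "range f \<subseteq> carrier H"
    and rel: "\<And>u v. (u, v) \<in> R \<Longrightarrow> eval_word H f u = eval_word H f v"
  shows "\<exists>!h. h \<in> hom (presented_group R) H \<inter> extensional (carrier (presented_group R)) \<and>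
           (\<forall>s. h (word_class R [(s, True)]) = f s)"
proof -
  interpret group H by fact
  interpret P: group "presented_group R" by (rule group_presented_group)
  have c: "f s \<in> carrier H" for s using f by auto
  note e = eval_word_closed[OF H f]
  note app = eval_word_append[OF H f]
  have eq: "eval_word H f u = eval_word H f v" if "word_eq R u v" for u v
    using that
  proof induction
    case (cancel s b)
    then show ?case by (cases b) (simp_all add: c)
  qed (auto simp: app rel)
  define h where "h = restrict (\<lambda>X. eval_word H f (SOME u. u \<in> X)) (range (word_class R))"
  have h: "h (word_class R u) = eval_word H f u" for u
  proof -
    have "u \<in> word_class R u" by (simp add: word_class_def word_eq.refl)
    then have "(SOME v. v \<in> word_class R u) \<in> word_class R u" by (rule someI)
    then have "eval_word H f u = eval_word H f (SOME v. v \<in> word_class R u)"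
      by (intro eq) (simp add: word_class_def)
    then show ?thesis by (simp add: h_def)
  qed
  have "h \<in> hom (presented_group R) H"
    by (auto simp: hom_def carrier_presented_group h e mult_presented_group app)
  moreover have hx: "h \<in> extensional (carrier (presented_group R))"
    by (simp add: h_def carrier_presented_group)
  moreover have "h (word_class R [(s, True)]) = f s" for s by (simp add: h c)
  moreover have "k = h"
    if k: "k \<in> hom (presented_group R) H" "k \<in> extensional (carrier (presented_group R))"
      and kf: "\<And>s. k (word_class R [(s, True)]) = f s" for k
  proof -
    interpret k: group_hom "presented_group R" H k by unfold_locales (rule k)
    have one: "k (word_class R []) = \<one>"
      using k.hom_one by (simp add: one_presented_group)
    have mult: "k (word_class R (u @ v)) = k (word_class R u) \<otimes> k (word_class R v)" for u v
      using hom_mult[OF k(1), of "word_class R u" "word_class R v"]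
      by (simp add: carrier_presented_group mult_presented_group)
    have kc: "k (word_class R u) \<in> carrier H" for u
      using k(1) by (auto simp: hom_def carrier_presented_group)
    have neg: "k (word_class R [(s, False)]) = inv f s" for s
    proof -
      have "word_class R ([(s, False)] @ [(s, True)]) = word_class R []"
        using word_eq.cancel[of R s False] by (simp add: word_class_eq_iff)
      then have "k (word_class R [(s, False)]) \<otimes> f s = \<one>"
        using mult[of "[(s, False)]" "[(s, True)]"] by (simp add: one kf)
      then show ?thesis using kc c by (metis inv_equality)
    qed
    have kw: "k (word_class R u) = eval_word H f u" for u
    proof (induction u)
      case (Cons x u)
      then show ?case
        using mult[of "[x]" u] kf neg by (cases x) auto
    qed (simp add: one)
    show ?thesis
      by (rule extensionalityI[OF k(2) hx])
         (auto simp: carrier_presented_group kw h)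
  qed
  ultimately show ?thesis by blast
qed

section \<open>The braid group on three strings\<close>

datatype braid_gen = S1 | S2

definition B3 :: "braid_gen word set monoid" where
  "B3 = presented_group
     {([(S1, True), (S2, True), (S1, True)], [(S2, True), (S1, True), (S2, True)])}"

section \<open>Left orders\<close>

text \<open>A left order is given by its strict relation \<open>{(f, g). f < g}\<close> on the carrier.\<close>

definition left_orders :: "('a, 'b) monoid_scheme \<Rightarrow> ('a \<times> 'a) set set" where
  "left_orders G = {r. r \<subseteq> carrier G \<times> carrier G \<and> irrefl r \<and> trans r \<and>
     total_on (carrier G) r \<and>
     (\<forall>f\<in>carrier G. \<forall>g\<in>carrier G. \<forall>h\<in>carrier G.
        (f, g) \<in> r \<longrightarrow> (h \<otimes>\<^bsub>G\<^esub> f, h \<otimes>\<^bsub>G\<^esub> g) \<in> r)}"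

definition order_sign :: "('a, 'b) monoid_scheme \<Rightarrow> ('a \<times> 'a) set \<Rightarrow> 'a \<Rightarrow> int" where
  "order_sign G r = (\<lambda>g\<in>carrier G - {\<one>\<^bsub>G\<^esub>}. if (\<one>\<^bsub>G\<^esub>, g) \<in> r then 1 else - 1)"

definition LO :: "('a, 'b) monoid_scheme \<Rightarrow> ('a \<Rightarrow> int) topology" where
  "LO G = subtopology
     (product_topology (\<lambda>_. discrete_topology {1, - 1}) (carrier G - {\<one>\<^bsub>G\<^esub>}))
     (order_sign G ` left_orders G)"

definition isolated_left_order :: "('a, 'b) monoid_scheme \<Rightarrow> ('a \<times> 'a) set \<Rightarrow> bool" where
  "isolated_left_order G r \<longleftrightarrow> r \<in> left_orders G \<and> openin (LO G) {order_sign G r}"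

definition pullback_order ::
    "('a, 'b) monoid_scheme \<Rightarrow> ('a \<Rightarrow> 'a) \<Rightarrow> ('a \<times> 'a) set \<Rightarrow> ('a \<times> 'a) set" where
  "pullback_order G \<phi> r = {(g, g') \<in> carrier G \<times> carrier G. (\<phi> g, \<phi> g') \<in> r}"

definition automorphic_image ::
    "('a, 'b) monoid_scheme \<Rightarrow> ('a \<times> 'a) set \<Rightarrow> ('a \<times> 'a) set \<Rightarrow> bool" where
  "automorphic_image G r r' \<longleftrightarrow> (\<exists>\<phi>\<in>auto G. r' = pullback_order G \<phi> r)"

lemma topspace_LO: "topspace (LO G) = order_sign G ` left_orders G"
proof -
  have "order_sign G r \<in> (\<Pi>\<^sub>E g\<in>carrier G - {\<one>\<^bsub>G\<^esub>}. {1, - 1})" for r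
    unfolding order_sign_def by (rule restrict_PiE_iff[THEN iffD2]) auto
  then show ?thesis by (auto simp: LO_def)
qed

lemma inj_on_order_sign:
  fixes G (structure)
  assumes "group G"
  shows "inj_on (order_sign G) (left_orders G)"
proof -
  interpret group G by fact
  have sub: "r \<subseteq> r'"
    if r: "r \<in> left_orders G" "r' \<in> left_orders G" "order_sign G r = order_sign G r'" for r r'
  proof
    fix p assume p: "p \<in> r"
    obtain f g where fg: "p = (f, g)" by force
    have c: "f \<in> carrier G" "g \<in> carrier G" and "f \<noteq> g"
      using r(1) p by (auto simp: left_orders_def fg irrefl_def)
    have "(inv f \<otimes> f, inv f \<otimes> g) \<in> r"
      using r(1) p c unfolding left_orders_def fg by blast
    then have "(\<one>, inv f \<otimes> g) \<in> r" using c by simp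
    moreover have "inv f \<otimes> g \<noteq> \<one>"
      using c \<open>f \<noteq> g\<close> by (metis inv_closed inv_equality inv_inv)
    ultimately have "(\<one>, inv f \<otimes> g) \<in> r'"
      using fun_cong[OF r(3), of "inv f \<otimes> g"] c by (simp add: order_sign_def split: if_splits)
    then have "(f \<otimes> \<one>, f \<otimes> (inv f \<otimes> g)) \<in> r'"
      using r(2) c unfolding left_orders_def by blast
    then show "p \<in> r'" using c by (simp add: fg m_assoc[symmetric])
  qed
  show ?thesis by (rule inj_onI) (use sub in \<open>metis subset_antisym\<close>)
qed

lemma pullback_order_left_orders:
  fixes G (structure)
  assumes "group G" "r \<in> left_orders G" "\<phi> \<in> auto G"
  shows "pullback_order G \<phi> r \<in> left_orders G"
proof -
  interpret group G by fact
  have h: "\<phi> \<in> hom G G" and b: "bij_betw \<phi> (carrier G) (carrier G)"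
    using assms(3) by (auto simp: auto_def Bij_def)
  have m: "\<phi> (x \<otimes> y) = \<phi> x \<otimes> \<phi> y" if "x \<in> carrier G" "y \<in> carrier G" for x y
    using h that by (simp add: hom_def)
  have c: "\<phi> x \<in> carrier G" if "x \<in> carrier G" for x using b that by (auto simp: bij_betw_def)
  have i: "\<phi> x \<noteq> \<phi> y" if "x \<in> carrier G" "y \<in> carrier G" "x \<noteq> y" for x y
    using b that by (auto simp: bij_betw_def inj_on_def)
  have r: "irrefl r" "trans r" "total_on (carrier G) r"
    "\<And>f g h. \<lbrakk>f \<in> carrier G; g \<in> carrier G; h \<in> carrier G; (f, g) \<in> r\<rbrakk> \<Longrightarrow> (h \<otimes> f, h \<otimes> g) \<in> r"
    using assms(2) by (auto simp: left_orders_def)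
  have "irrefl (pullback_order G \<phi> r)"
    using r(1) by (auto simp: pullback_order_def irrefl_def)
  moreover have "trans (pullback_order G \<phi> r)"
    using r(2) by (auto simp: pullback_order_def intro!: transI dest: transD)
  moreover have "total_on (carrier G) (pullback_order G \<phi> r)"
    using r(3) i c by (auto simp: pullback_order_def total_on_def)
  ultimately show ?thesis
    using r(4) c by (auto simp: left_orders_def pullback_order_def m)
qed

end

theory Submission
  imports Defs "HOL-Algebra.Generated_Groups" "HOL-Number_Theory.Cong"
begin

text \<open>
  With \<open>x = \<sigma>\<^sub>1\<sigma>\<^sub>2\<sigma>\<^sub>1\<close> and \<open>y = \<sigma>\<^sub>1\<sigma>\<^sub>2\<close> the braid group becomes the group of the trefoil knot,
  generated by \<open>x\<close> and \<open>y\<close> with \<open>x\<^sup>2 = y\<^sup>3\<close>. The element \<open>z = x\<^sup>2\<close> is central, and modulo \<open>z\<close>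
  the group is the free product of a group of order two and a group of order three.

  \<^bold>\<open>The orders.\<close> Let \<open>x\<close> act on the real line by a map that lifts an involution of the circle
  of length 6, and \<open>y\<close> by the translation by 2; the square of the first and the cube of the second are
  the translation by 6. The arcs \<open>Y\<^sub>i = [6i, 6i + 5)\<close> and \<open>X\<^sub>i = [6i - 1, 6i)\<close> alternate along the line, \<open>x\<close> moves
  \<open>Y\<^sub>i\<close> onto \<open>X\<^sub>i\<^sub>+\<^sub>1\<close>, while \<open>y\<close> and \<open>y\<^sup>2\<close> move \<open>X\<^sub>i\<close> into \<open>Y\<^sub>i\<close>. For every \<open>n \<ge> 0\<close> the relation
  survives when \<open>x\<close> is composed with the translation by \<open>18n\<close> and \<open>y\<close> with the translation by
  \<open>12n\<close>; then \<open>z\<close> translates by \<open>6k\<close> where \<open>k = 6n + 1\<close>. Geometrically this is the first action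
  lifted to a \<open>k\<close>-fold cover of the circle. Ping-pong shows that the
  stabiliser of the point \<open>0\<close> is trivial, so \<open>f < g\<close> iff \<open>f 0 < g 0\<close> is a left order (\<open>ord\<close>).
  For \<open>n = 0\<close> it is the order of Dubrovina and Dubrovin, with positive cone generated by
  \<open>\<sigma>\<^sub>1\<sigma>\<^sub>2\<close> and \<open>\<sigma>\<^sub>2\<^sup>-\<^sup>1\<close>.

  \<^bold>\<open>Isolation.\<close> The action enters the ping-pong argument only through the cyclic arrangement of
  the arcs, and this arrangement can be expressed inside the ordered group. The group elements
  \<open>s\<^sub>i\<close> (\<open>marker\<close>) represent the least orbit point in \<open>Y\<^sub>i\<close>, and then \<open>x s\<^sub>i\<^sub>-\<^sub>3\<^sub>n\<^sub>-\<^sub>1\<close> represents the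
  least one in \<open>X\<^sub>i\<close>. Some inequalities between these elements, finitely many modulo \<open>z\<close>, imply by
  induction over normal forms that every group element lies between the markers of its own arc
  (\<open>between_markers\<close>). Hence a left order that satisfies these inequalities makes every element
  positive that is positive in \<open>ord\<close>, and so equals \<open>ord\<close> (\<open>isolated_ord\<close>).

  \<^bold>\<open>Automorphisms.\<close> The order with parameter \<open>n\<close> has a least positive element, namely
  \<open>(yx)\<^sup>k z\<^sup>-\<^sup>(\<^sup>5\<^sup>n\<^sup>+\<^sup>1\<^sup>)\<close> (\<open>least_pos_least\<close>). An automorphism that carries one of the orders to another
  matches the least positive elements. In \<open>SL\<^sub>2(\<int>)\<close> they become, up to
  sign, unipotent matrices with off-diagonal entry \<open>-k\<close>, and such a matrix has roots only of orders
  dividing \<open>k\<close>. As automorphisms preserve the centre, which goes to \<open>\<plusminus>1\<close>, the two values of \<open>k\<close>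
  divide each other (\<open>least_pos_root_dvd\<close>).
\<close>

section \<open>The group of the trefoil knot\<close>

text \<open>That \<open>x\<^sup>2 = y\<^sup>3\<close> is the only relation enters later, through the existence of the
  ping-pong actions.\<close>

locale trefoil_group = group G for G (structure) +
  fixes x y
  assumes x_closed [simp]: "x \<in> carrier G" and y_closed [simp]: "y \<in> carrier G"
    and square_eq_cube: "x \<otimes> x = y \<otimes> (y \<otimes> y)"
    and generated: "carrier G \<subseteq> generate G {x, y}"
begin

definition z where "z = x \<otimes> x"

lemma z_closed [simp]: "z \<in> carrier G"
  by (simp add: z_def)

lemma xx: "x \<otimes> x = z" and yyy: "y \<otimes> (y \<otimes> y) = z"
  by (simp_all add: z_def square_eq_cube)

lemma xx_mult: "g \<in> carrier G \<Longrightarrow> x \<otimes> (x \<otimes> g) = z \<otimes> g"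
  by (simp add: xx [symmetric] m_assoc)

lemma yyy_mult: "g \<in> carrier G \<Longrightarrow> y \<otimes> (y \<otimes> (y \<otimes> g)) = z \<otimes> g"
  by (simp add: yyy [symmetric] m_assoc)

lemma subgroup_centralizer:
  assumes "c \<in> carrier G"
  shows "subgroup {g \<in> carrier G. c \<otimes> g = g \<otimes> c} G"
proof (rule subgroupI)
  fix g assume "g \<in> {g \<in> carrier G. c \<otimes> g = g \<otimes> c}"
  then have g: "g \<in> carrier G" "c \<otimes> g = g \<otimes> c" by auto
  have "c \<otimes> inv g = inv g \<otimes> c"
    using g assms by (metis inv_closed inv_solve_left inv_solve_right m_assoc m_closed)
  then show "inv g \<in> {g \<in> carrier G. c \<otimes> g = g \<otimes> c}" using g by simp
next
  fix g h assume "g \<in> {g \<in> carrier G. c \<otimes> g = g \<otimes> c}" "h \<in> {g \<in> carrier G. c \<otimes> g = g \<otimes> c}"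
  then show "g \<otimes> h \<in> {g \<in> carrier G. c \<otimes> g = g \<otimes> c}"
    using assms by (auto simp: m_assoc) (metis m_assoc)
qed (use assms in auto)

lemma z_comm:
  assumes "g \<in> carrier G"
  shows "g \<otimes> z = z \<otimes> g"
proof -
  have "x \<otimes> z = z \<otimes> x"
    by (simp add: z_def m_assoc)
  moreover have "y \<otimes> z = z \<otimes> y"
    by (simp only: yyy [symmetric] m_assoc y_closed m_closed)
  ultimately have "generate G {x, y} \<subseteq> {g \<in> carrier G. z \<otimes> g = g \<otimes> z}"
    by (intro generate_subgroup_incl subgroup_centralizer) auto
  then show ?thesis using generated assms by auto
qed

lemma zpow_comm:
  assumes "g \<in> carrier G"
  shows "g \<otimes> z [^] (j::int) = z [^] j \<otimes> g"
  using subgroup_int_pow_closed [OF subgroup_centralizer [OF assms], of z j] z_comm assms by auto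

text \<open>Multiplying on the left by a letter either extends a normal form, merges two \<open>y\<close>
  syllables, or produces a central factor \<open>z\<close>; the two sets are therefore together closed
  under left multiplication by the generators and exhaust the group.\<close>

inductive_set x_initial and y_initial where
  central: "z [^] (j::int) \<in> y_initial"
| x: "g \<in> y_initial \<Longrightarrow> x \<otimes> g \<in> x_initial"
| y: "g \<in> x_initial \<Longrightarrow> y \<otimes> g \<in> y_initial"
| yy: "g \<in> x_initial \<Longrightarrow> y \<otimes> (y \<otimes> g) \<in> y_initial"
| y_central: "y \<otimes> z [^] (j::int) \<in> y_initial"
| yy_central: "y \<otimes> (y \<otimes> z [^] (j::int)) \<in> y_initial"

lemma initial_closed:
  "g \<in> x_initial \<Longrightarrow> g \<in> carrier G"
  "g \<in> y_initial \<Longrightarrow> g \<in> carrier G"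
  by (induction rule: x_initial_y_initial.inducts) auto

text \<open>Oriented so that the simplifier moves central powers to the right of the letters.\<close>

lemma zpow_mult_letter:
  assumes "g \<in> carrier G"
  shows "z [^] (i::int) \<otimes> (x \<otimes> g) = x \<otimes> (z [^] i \<otimes> g)"
    and "z [^] (i::int) \<otimes> (y \<otimes> g) = y \<otimes> (z [^] i \<otimes> g)"
  using assms by (simp_all add: m_assoc [symmetric] zpow_comm)

lemma zpow_mult_initial:
  "g \<in> x_initial \<Longrightarrow> z [^] (i::int) \<otimes> g \<in> x_initial"
  "g \<in> y_initial \<Longrightarrow> z [^] (i::int) \<otimes> g \<in> y_initial"
  by (induction rule: x_initial_y_initial.inducts)
     (auto simp: zpow_mult_letter initial_closed int_pow_mult [symmetric]
        intro: x_initial_y_initial.intros)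

lemma z_mult_initial:
  "g \<in> x_initial \<Longrightarrow> z \<otimes> g \<in> x_initial"
  "g \<in> y_initial \<Longrightarrow> z \<otimes> g \<in> y_initial"
  using zpow_mult_initial [where i = 1] by auto

lemma letter_mult_initial:
  assumes "g \<in> x_initial \<union> y_initial"
  shows "x \<otimes> g \<in> x_initial \<union> y_initial" and "y \<otimes> g \<in> x_initial \<union> y_initial"
proof -
  have "z \<otimes> z [^] (j::int) \<in> y_initial" for j
    by (intro z_mult_initial central)
  then show "y \<otimes> g \<in> x_initial \<union> y_initial"
    using assms
    by (auto elim!: y_initial.cases
        simp: yyy_mult initial_closed z_mult_initial intro: x_initial_y_initial.intros)
  show "x \<otimes> g \<in> x_initial \<union> y_initial"
    using assms
    by (auto elim!: x_initial.cases
        simp: xx_mult initial_closed z_mult_initial intro: x_initial_y_initial.intros)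
qed

lemma normal_form:
  assumes "g \<in> carrier G"
  shows "g \<in> x_initial \<union> y_initial"
proof -
  let ?N = "x_initial \<union> y_initial"
  have inv_x: "inv x = z [^] (-1::int) \<otimes> x"
    by (rule inv_equality)
       (simp_all add: m_assoc xx int_pow_neg)
  have inv_y: "inv y = z [^] (-1::int) \<otimes> (y \<otimes> y)"
    by (rule inv_equality)
       (simp_all add: m_assoc yyy int_pow_neg)
  have step: "a \<otimes> h \<in> ?N" if "a \<in> generate G {x, y}" "h \<in> ?N" for a h
    using that
  proof (induction arbitrary: h)
    case one
    then show ?case using initial_closed by auto
  next
    case (incl a)
    then show ?case using letter_mult_initial by auto
  next
    case (inv a)
    have h: "h \<in> carrier G" using inv.prems initial_closed by auto
    show ?case
    proof (cases "a = x")
      case True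
      then show ?thesis
        using zpow_mult_initial letter_mult_initial(1) [OF inv.prems] h
        by (auto simp: inv_x m_assoc)
    next
      case False
      then have "a = y" using inv by auto
      then show ?thesis
        using zpow_mult_initial letter_mult_initial(2) [OF letter_mult_initial(2) [OF inv.prems]] h
        by (auto simp: inv_y m_assoc)
    qed
  next
    case (eng a b)
    have c: "a \<in> carrier G" "b \<in> carrier G"
      using eng generate_in_carrier [of "{x, y}"] by auto
    have "h \<in> carrier G" using eng.prems initial_closed by auto
    then show ?case using eng.IH(1) [OF eng.IH(2) [OF eng.prems]] c by (simp add: m_assoc)
  qed
  have "\<one> \<in> ?N" using central [of 0] by simp
  from step [OF _ this, of g] show ?thesis using assms generated by auto
qed

text \<open>In the braid group this is, modulo the centre, a parabolic element of the modular group.\<close>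

definition u where "u = y \<otimes> x"

lemma u_closed [simp]: "u \<in> carrier G"
  by (simp add: u_def)

text \<open>The exponent of \<open>z\<close> is chosen so that the total rotation vanishes: \<open>yx\<close> shifts the arcs by
  \<open>5n + 1\<close> places and \<open>z\<close> shifts them by \<open>6n + 1\<close>. For \<open>n = 0\<close> this is \<open>y x\<^sup>-\<^sup>1\<close>, which is
  \<open>\<sigma>\<^sub>2\<^sup>-\<^sup>1\<close> in the braid group.\<close>

definition least_pos where
  "least_pos n = u [^] (6 * n + 1) \<otimes> z [^] (- (5 * n + 1) :: int)"

text \<open>The least orbit point in the \<open>i\<close>-th \<open>Y\<close> arc is reached from the base point by a power of
  \<open>yx\<close>, because \<open>yx\<close> carries the least point of an arc to the least point of the arc that
  comes \<open>5n + 1\<close> places later, unless that arc starts with a central element. Since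
  \<open>6 (5n + 1)\<close> is \<open>1\<close> modulo \<open>6n + 1\<close>, the power needed to arrive at arc \<open>i\<close> is \<open>6i\<close> modulo \<open>6n + 1\<close>; a power of \<open>z\<close> then
  corrects the position (\<open>marker_index\<close>).\<close>

definition marker :: "int \<Rightarrow> int \<Rightarrow> 'a" where
  "marker n i =
     u [^] (6 * i mod (6 * n + 1)) \<otimes> z [^] ((i - (6 * i mod (6 * n + 1)) * (5 * n + 1)) div (6 * n + 1))"

lemma least_pos_closed [simp]: "least_pos n \<in> carrier G"
  by (simp add: least_pos_def)

lemma marker_closed [simp]: "marker n i \<in> carrier G"
  by (simp add: marker_def)

lemma marker_add_period:
  assumes "0 \<le> n"
  shows "marker n (i + (6 * n + 1)) = z \<otimes> marker n i"
proof -
  let ?k = "6 * n + 1"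
  have m: "6 * (i + ?k) mod ?k = 6 * i mod ?k"
    by (metis distrib_left mod_mult_self4 mult.commute add.commute)
  have "(i + ?k - (6 * i mod ?k) * (5 * n + 1)) div ?k =
      (i - (6 * i mod ?k) * (5 * n + 1)) div ?k + 1"
    using assms div_add_self2 [of ?k "i - (6 * i mod ?k) * (5 * n + 1)"]
    by (simp add: algebra_simps)
  then have "marker n (i + ?k) =
      u [^] (6 * i mod ?k) \<otimes> (z [^] ((i - (6 * i mod ?k) * (5 * n + 1)) div ?k) \<otimes> z [^] (1::int))"
    unfolding marker_def m by (simp only: int_pow_mult z_closed)
  then show ?thesis
    by (simp add: marker_def m_assoc [symmetric] z_comm)
qed

lemma marker_add_mult_period:
  assumes "0 \<le> n"
  shows "marker n (i + j * (6 * n + 1)) = z [^] j \<otimes> marker n i"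
proof (induction j rule: int_induct [where k = 0])
  case base
  then show ?case by simp
next
  case (step1 j)
  have "marker n (i + (j + 1) * (6 * n + 1)) = z \<otimes> marker n (i + j * (6 * n + 1))"
    using marker_add_period [OF assms, of "i + j * (6 * n + 1)"] by (simp add: algebra_simps)
  also have "\<dots> = z [^] (1 + j) \<otimes> marker n i"
    by (simp only: int_pow_mult z_closed step1) (simp add: m_assoc)
  finally show ?case by (simp add: add.commute)
next
  case (step2 j)
  have "z \<otimes> marker n (i + (j - 1) * (6 * n + 1)) = z [^] j \<otimes> marker n i"
    using marker_add_period [OF assms, of "i + (j - 1) * (6 * n + 1)"] step2
    by (simp add: algebra_simps)
  also have "\<dots> = z [^] (1 + (j - 1)) \<otimes> marker n i"
    by simp
  also have "\<dots> = z \<otimes> (z [^] (j - 1) \<otimes> marker n i)"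
    by (simp only: int_pow_mult z_closed int_pow_1) (simp add: m_assoc)
  finally show ?case
    by simp
qed

lemma marker_0 [simp]: "marker n 0 = \<one>"
  by (simp add: marker_def)

lemma marker_mult_period:
  assumes "0 \<le> n"
  shows "marker n (j * (6 * n + 1)) = z [^] j"
  using marker_add_mult_period [OF assms, of 0 j] by simp

lemma marker_index:
  assumes "0 \<le> n"
  shows "i = (6 * i mod (6 * n + 1)) * (5 * n + 1) +
    (i - (6 * i mod (6 * n + 1)) * (5 * n + 1)) div (6 * n + 1) * (6 * n + 1 :: int)"
proof -
  let ?k = "6 * n + 1"
  \<comment> \<open>\<open>6 (5n + 1) = 5 (6n + 1) + 1\<close>\<close>
  have "(i - (6 * i) * (5 * n + 1)) = (- 5 * i) * ?k" by (simp add: algebra_simps)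
  then have "[i = (6 * i) * (5 * n + 1)] (mod ?k)"
    by (simp add: cong_iff_dvd_diff)
  moreover have "[(6 * i) * (5 * n + 1) = (6 * i mod ?k) * (5 * n + 1)] (mod ?k)"
    by (intro cong_mult) (simp_all add: cong_def)
  ultimately have "[i = (6 * i mod ?k) * (5 * n + 1)] (mod ?k)"
    by (rule cong_trans)
  then show ?thesis
    by (simp add: cong_iff_dvd_diff)
qed

text \<open>The chain of markers under \<open>yx\<close> closes up only after \<open>6n + 1\<close> steps, and
  the defect is then exactly \<open>least_pos n\<close>.\<close>

lemma u_marker:
  assumes "0 \<le> n"
  shows "u \<otimes> marker n i = marker n (i + 5 * n + 1) \<or>
    (\<exists>j. marker n (i + 5 * n + 1) = z [^] (j::int) \<and> u \<otimes> marker n i = least_pos n \<otimes> z [^] j)"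
proof -
  define k where "k = 6 * n + 1"
  define m where "m = 6 * i mod k"
  define a where "a = (i - m * (5 * n + 1)) div k"
  have k: "k > 0" using assms by (simp add: k_def)
  have marker_i: "marker n i = u [^] m \<otimes> z [^] a"
    by (simp add: marker_def m_def a_def k_def)
  then have u: "u \<otimes> marker n i = u [^] (m + 1) \<otimes> z [^] a"
    using int_pow_mult [of u 1 m] by (simp add: m_assoc [symmetric] add.commute)
  have i: "i = m * (5 * n + 1) + a * k"
    unfolding a_def m_def k_def by (rule marker_index [OF assms])
  have "6 * (i + 5 * n + 1) = (6 * i + 1) + 5 * k"
    by (simp add: k_def algebra_simps)
  then have m': "6 * (i + 5 * n + 1) mod k = (m + 1) mod k"
    by (simp only: m_def mod_mult_self1 mod_add_left_eq)
  show ?thesis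
  proof (cases "m + 1 = k")
    case False
    moreover have "0 \<le> m" "m < k" using k by (simp_all add: m_def)
    ultimately have "(m + 1) mod k = m + 1" by simp
    moreover have "(i + 5 * n + 1 - (m + 1) * (5 * n + 1)) = a * k"
      by (subst i) (simp add: algebra_simps)
    ultimately have "marker n (i + 5 * n + 1) = u [^] (m + 1) \<otimes> z [^] a"
      using k unfolding marker_def k_def [symmetric] m' by simp
    then show ?thesis using u by simp
  next
    case True
    then have "(m + 1) mod k = 0" by simp
    moreover have "i + 5 * n + 1 = (5 * n + 1 + a) * k"
    proof -
      have "i + 5 * n + 1 = (m + 1) * (5 * n + 1) + a * k"
        by (subst i) (simp add: algebra_simps)
      then show ?thesis unfolding True by (simp add: algebra_simps)
    qed
    ultimately have "marker n (i + 5 * n + 1) = z [^] (5 * n + 1 + a)"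
      using marker_mult_period [OF assms, of "5 * n + 1 + a"] by (simp add: k_def)
    moreover have "u \<otimes> marker n i = least_pos n \<otimes> z [^] (5 * n + 1 + a)"
    proof -
      have "z [^] a = z [^] (- (5 * n + 1)) \<otimes> z [^] (5 * n + 1 + a)"
        by (simp only: int_pow_mult [OF z_closed, symmetric]) simp
      then show ?thesis
        unfolding u True least_pos_def k_def by (simp add: m_assoc)
    qed
    ultimately show ?thesis by blast
  qed
qed

end

section \<open>Left orders and a criterion for isolation\<close>

locale left_ordered_group = group G for G (structure) +
  fixes lt (infix "\<lless>" 50)
  assumes irrefl: "\<not> f \<lless> f"
    and less_trans [trans]: "f \<lless> g \<Longrightarrow> g \<lless> h \<Longrightarrow> f \<lless> h"
    and total: "f \<in> carrier G \<Longrightarrow> g \<in> carrier G \<Longrightarrow> f \<noteq> g \<Longrightarrow> f \<lless> g \<or> g \<lless> f"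
    and mult_less: "f \<in> carrier G \<Longrightarrow> g \<in> carrier G \<Longrightarrow> h \<in> carrier G \<Longrightarrow> f \<lless> g \<Longrightarrow> h \<otimes> f \<lless> h \<otimes> g"
begin

definition le (infix "\<lless>\<^sup>=" 50) where "f \<lless>\<^sup>= g \<longleftrightarrow> f \<lless> g \<or> f = g"

lemma le_refl [simp]: "f \<lless>\<^sup>= f"
  by (simp add: le_def)

lemma less_imp_le: "f \<lless> g \<Longrightarrow> f \<lless>\<^sup>= g"
  by (simp add: le_def)

lemma le_less_trans [trans]: "f \<lless>\<^sup>= g \<Longrightarrow> g \<lless> h \<Longrightarrow> f \<lless> h"
  and less_le_trans [trans]: "f \<lless> g \<Longrightarrow> g \<lless>\<^sup>= h \<Longrightarrow> f \<lless> h"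
  and le_trans [trans]: "f \<lless>\<^sup>= g \<Longrightarrow> g \<lless>\<^sup>= h \<Longrightarrow> f \<lless>\<^sup>= h"
  by (auto simp: le_def intro: less_trans)

lemma mult_le:
  "f \<in> carrier G \<Longrightarrow> g \<in> carrier G \<Longrightarrow> h \<in> carrier G \<Longrightarrow> f \<lless>\<^sup>= g \<Longrightarrow> h \<otimes> f \<lless>\<^sup>= h \<otimes> g"
  by (auto simp: le_def mult_less)

lemma mult_less_cancel:
  assumes "f \<in> carrier G" "g \<in> carrier G" "h \<in> carrier G"
  shows "h \<otimes> f \<lless> h \<otimes> g \<longleftrightarrow> f \<lless> g"
  using mult_less [OF assms] mult_less [of "h \<otimes> f" "h \<otimes> g" "inv h"] assms
  by (auto simp: m_assoc [symmetric])

lemma mult_le_cancel: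
  assumes "f \<in> carrier G" "g \<in> carrier G" "h \<in> carrier G"
  shows "h \<otimes> f \<lless>\<^sup>= h \<otimes> g \<longleftrightarrow> f \<lless>\<^sup>= g"
  using assms by (simp add: le_def mult_less_cancel)

lemma one_less_quotient:
  assumes "f \<in> carrier G" "g \<in> carrier G"
  shows "\<one> \<lless> inv f \<otimes> g \<longleftrightarrow> f \<lless> g"
  using mult_less_cancel [of \<one> "inv f \<otimes> g" f] assms by (simp add: m_assoc [symmetric])

end

lemma left_orders_left_ordered_group:
  assumes "group G" "r \<in> left_orders G"
  shows "left_ordered_group G (\<lambda>f g. (f, g) \<in> r)"
proof -
  interpret group G by fact
  show ?thesis
    using assms(2)
    by unfold_locales
      (auto simp: left_orders_def irrefl_def total_on_def dest: transD)
qed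

lemma left_orders_eqI:
  assumes "r \<in> left_orders G" "r' \<in> left_orders G" "r \<subseteq> r'"
  shows "r = r'"
proof
  show "r' \<subseteq> r"
  proof
    fix p assume p: "p \<in> r'"
    obtain f g where fg: "p = (f, g)" by force
    have "f \<in> carrier G" "g \<in> carrier G" "f \<noteq> g"
      using assms(2) p by (auto simp: left_orders_def irrefl_def fg)
    then have "(f, g) \<in> r \<or> (g, f) \<in> r"
      using assms(1) by (auto simp: left_orders_def total_on_def)
    moreover have "(g, f) \<notin> r'"
      using assms(2) p by (auto simp: left_orders_def irrefl_def fg dest: transD)
    ultimately show "p \<in> r" using assms(3) fg by auto
  qed
qed fact

text \<open>Inclusion suffices for uniqueness because left orders are total (\<open>left_orders_eqI\<close>); prescribing
  finitely many signs gives a basic open set of the product topology.\<close>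

lemma isolated_if_finitely_determined:
  fixes G (structure)
  assumes r: "r \<in> left_orders G"
    and F: "finite F" "F \<subseteq> carrier G" "\<And>f. f \<in> F \<Longrightarrow> (\<one>, f) \<in> r"
    and unique: "\<And>r'. r' \<in> left_orders G \<Longrightarrow> (\<And>f. f \<in> F \<Longrightarrow> (\<one>, f) \<in> r') \<Longrightarrow> r \<subseteq> r'"
  shows "isolated_left_order G r"
proof -
  let ?I = "carrier G - {\<one>}"
  have one: "\<one> \<notin> F"
    using r F(3) by (auto simp: left_orders_def irrefl_def)
  define U where "U = (\<Pi>\<^sub>E g\<in>?I. if g \<in> F then {1::int} else {1, -1})"
  have "finite {g \<in> ?I. (if g \<in> F then {1::int} else {1, -1}) \<noteq> {1, -1}}"
    by (rule finite_subset [OF _ F(1)]) auto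
  then have "openin (product_topology (\<lambda>_. discrete_topology {1, -1}) ?I) U"
    by (simp add: U_def openin_PiE_gen)
  moreover have "U \<inter> order_sign G ` left_orders G = {order_sign G r}"
  proof (intro equalityI subsetI)
    fix h assume "h \<in> U \<inter> order_sign G ` left_orders G"
    then obtain r' where r': "r' \<in> left_orders G" "h = order_sign G r'" and h: "h \<in> U" by blast
    have "(\<one>, f) \<in> r'" if "f \<in> F" for f
    proof -
      have "f \<in> ?I" using that one F(2) by auto
      then have "h f \<in> (if f \<in> F then {1} else {1, -1})"
        using h unfolding U_def by (rule PiE_mem [rotated])
      then show ?thesis
        using that \<open>f \<in> ?I\<close> by (auto simp: r'(2) order_sign_def split: if_splits)
    qed
    then have "r = r'" by (intro left_orders_eqI [OF r r'(1)] unique r'(1))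
    then show "h \<in> {order_sign G r}" using r' by simp
  next
    fix h assume "h \<in> {order_sign G r}"
    then have h: "h = order_sign G r" by simp
    have "order_sign G r \<in> U"
      unfolding U_def using F(3) by (auto simp: order_sign_def)
    then show "h \<in> U \<inter> order_sign G ` left_orders G" using r h by blast
  qed
  ultimately have "openin (LO G) {order_sign G r}"
    unfolding LO_def openin_subtopology by metis
  then show ?thesis using r by (simp add: isolated_left_order_def)
qed

section \<open>Markers\<close>

text \<open>These are the inequalities that pin an order down. Write \<open>p\<^sub>i = x s\<^sub>i\<^sub>-\<^sub>3\<^sub>n\<^sub>-\<^sub>1\<close> for the left end of
  the arc \<open>X\<^sub>i\<close>. They say \<open>s\<^sub>i < p\<^sub>i\<^sub>+\<^sub>1\<close>, so that the arcs alternate, and \<open>y s\<^sub>i < p\<^sub>i\<^sub>+\<^sub>2\<^sub>n\<^sub>+\<^sub>1\<close>, so that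
  \<open>y\<close> does not push \<open>X\<^sub>i\<close> beyond \<open>Y\<^sub>i\<^sub>+\<^sub>2\<^sub>n\<close>. The last two treat the central elements,
  which are left ends of arcs themselves: \<open>y\<^sup>2\<close> keeps them strictly to the left of the next arc, and
  the marker that \<open>yx\<close> moves into their arc arrives to the right of them.\<close>

locale marked_trefoil_order = trefoil_group + left_ordered_group +
  fixes n :: int
  assumes n_nonneg: "0 \<le> n"
    and marker_less_x: "marker n i \<lless> x \<otimes> marker n (i - 3 * n)"
    and y_marker_less_x: "y \<otimes> marker n i \<lless> x \<otimes> marker n (i - n)"
    and yy_less_x: "y \<otimes> y \<lless> x \<otimes> marker n n"
    and least_pos_pos: "\<one> \<lless> least_pos n"
begin

abbreviation s where "s \<equiv> marker n"

abbreviation k where "k \<equiv> 6 * n + 1"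

lemma marker_shift: "s (i + k) = z \<otimes> s i"
  by (rule marker_add_period [OF n_nonneg])

text \<open>In terms of \<open>p\<^sub>i\<close> this is \<open>s\<^sub>i\<^sub>+\<^sub>2\<^sub>n \<le> y p\<^sub>i\<close>: the other half of the inclusion of \<open>y X\<^sub>i\<close> in
  \<open>Y\<^sub>i\<^sub>+\<^sub>2\<^sub>n\<close>.\<close>

lemma marker_le_u: "s (i + 5 * n + 1) \<lless>\<^sup>= u \<otimes> s i"
proof -
  consider "u \<otimes> s i = s (i + 5 * n + 1)"
    | j where "s (i + 5 * n + 1) = z [^] (j::int)" "u \<otimes> s i = least_pos n \<otimes> z [^] j"
    using u_marker [OF n_nonneg, of i] by blast
  then show ?thesis
  proof cases
    case 2
    have "z [^] j \<otimes> \<one> \<lless> z [^] j \<otimes> least_pos n"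
      by (intro mult_less least_pos_pos) auto
    then show ?thesis using 2 zpow_comm [of "least_pos n" j] by (simp add: le_def)
  qed simp
qed

lemma x_marker_less: "x \<otimes> s (i - 3 * n - 1) \<lless> s i"
proof -
  have "x \<otimes> s (i - 3 * n - 1) \<lless> x \<otimes> (x \<otimes> s (i - 3 * n - 1 - 3 * n))"
    by (intro mult_less marker_less_x) auto
  also have "\<dots> = s i"
    using marker_shift [of "i - k"] by (simp add: xx_mult algebra_simps)
  finally show ?thesis .
qed

lemma marker_less_succ: "s i \<lless> s (i + 1)"
proof -
  have "s i \<lless> x \<otimes> s (i - 3 * n)"
    by (rule marker_less_x)
  also have "\<dots> \<lless> s (i + 1)"
    using x_marker_less [of "i + 1"] by (simp add: algebra_simps)
  finally show ?thesis .
qed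

lemma marker_strict_mono: "i < j \<Longrightarrow> s i \<lless> s j"
proof (induction rule: int_less_induct)
  case base
  show ?case using marker_less_succ [of "j - 1"] by simp
next
  case (step i)
  then show ?case using marker_less_succ [of "i - 1"] less_trans by simp
qed

text \<open>The upper bound \<open>g \<le> s\<^sub>i\<close> is not strict so that the lemma also covers a central \<open>g\<close>, which
  equals its marker.\<close>

lemma y_step:
  assumes "g \<in> carrier G" "x \<otimes> s (i - 3 * n - 1) \<lless>\<^sup>= g" "g \<lless>\<^sup>= s i"
  shows "s (i + 2 * n) \<lless>\<^sup>= y \<otimes> g" and "y \<otimes> g \<lless> x \<otimes> s (i + 2 * n - 3 * n)"
proof -
  have "s (i + 2 * n) \<lless>\<^sup>= u \<otimes> s (i - 3 * n - 1)"
    using marker_le_u [of "i - 3 * n - 1"] by (simp add: algebra_simps)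
  also have "\<dots> = y \<otimes> (x \<otimes> s (i - 3 * n - 1))"
    by (simp add: u_def m_assoc)
  also have "\<dots> \<lless>\<^sup>= y \<otimes> g"
    using assms by (intro mult_le) auto
  finally show "s (i + 2 * n) \<lless>\<^sup>= y \<otimes> g" .
  have "y \<otimes> g \<lless>\<^sup>= y \<otimes> s i"
    using assms by (intro mult_le) auto
  also have "\<dots> \<lless> x \<otimes> s (i - n)"
    by (rule y_marker_less_x)
  finally show "y \<otimes> g \<lless> x \<otimes> s (i + 2 * n - 3 * n)" by simp
qed

text \<open>Bounds for \<open>y\<^sup>2\<close> come for free: since \<open>y\<^sup>3\<close> is central, multiplying the two inequalities for
  \<open>y\<close> by \<open>y\<^sup>2\<close> or \<open>y\<^sup>-\<^sup>1\<close> exchanges the roles of lower and upper ends.\<close>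

lemma yy_lower:
  assumes "g \<in> carrier G" "x \<otimes> s (i - 3 * n - 1) \<lless>\<^sup>= g"
  shows "s (i + 4 * n) \<lless>\<^sup>= y \<otimes> (y \<otimes> g)"
proof -
  have "s (i + 4 * n) = y \<otimes> (y \<otimes> (y \<otimes> s (i - 2 * n - 1)))"
    using marker_shift [of "i - 2 * n - 1"] by (simp add: yyy_mult algebra_simps)
  also have "\<dots> \<lless> y \<otimes> (y \<otimes> (x \<otimes> s (i - 2 * n - 1 - n)))"
    by (intro mult_less y_marker_less_x) auto
  also have "\<dots> \<lless>\<^sup>= y \<otimes> (y \<otimes> g)"
    using assms by (intro mult_le) (auto simp: algebra_simps)
  finally show ?thesis by (rule less_imp_le)
qed

lemma yy_marker_le: "y \<otimes> (y \<otimes> s i) \<lless>\<^sup>= x \<otimes> s (i + n)"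
proof -
  have "y \<otimes> (y \<otimes> (y \<otimes> s i)) \<lless>\<^sup>= y \<otimes> (x \<otimes> s (i + n))"
    using marker_le_u [of "i + n"] marker_shift [of i]
    by (simp add: yyy_mult u_def m_assoc algebra_simps)
  then show ?thesis by (subst (asm) mult_le_cancel) auto
qed

lemma yy_zpow_less: "y \<otimes> (y \<otimes> z [^] (j::int)) \<lless> x \<otimes> s (j * k + n)"
proof -
  have "z [^] j \<otimes> (y \<otimes> y) \<lless> z [^] j \<otimes> (x \<otimes> s n)"
    by (intro mult_less yy_less_x) auto
  moreover have "z [^] j \<otimes> s n = s (j * k + n)"
    using marker_add_mult_period [OF n_nonneg, of n j] by (simp add: add.commute)
  moreover have "z [^] j \<otimes> (y \<otimes> y) = y \<otimes> (y \<otimes> z [^] j)"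
    by (simp add: zpow_mult_letter zpow_comm)
  ultimately show ?thesis by (simp add: zpow_mult_letter)
qed

lemma marker_zpow: "s (j * k) = z [^] j"
  by (rule marker_mult_period [OF n_nonneg])

end

section \<open>A half turn of the line\<close>

text \<open>The lift to the line of the piecewise linear involution that exchanges the arcs \<open>[0, 5)\<close> and
  \<open>[5, 6)\<close> of the circle of length 6. The arc lengths are chosen so that the three translates of \<open>[5, 6)\<close>
  by multiples of 2 are disjoint and two of them lie inside \<open>(0, 5)\<close> modulo 6.\<close>

definition half_turn :: "real \<Rightarrow> real" where
  "half_turn t = (let c = 6 * of_int \<lfloor>t / 6\<rfloor>; d = t - c in c + (if d < 5 then d / 5 + 5 else 5 * d - 19))"

text \<open>On each arc the map is affine. No quotients of sums are used, so that
  linear arithmetic can apply the formulas.\<close>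

lemma half_turn_low:
  assumes "6 * of_int i \<le> t" "t < 6 * of_int i + 5"
  shows "half_turn t = t / 5 + 24 / 5 * of_int i + 5"
proof -
  have "\<lfloor>t / 6\<rfloor> = i" using assms by linarith
  then show ?thesis using assms by (simp add: half_turn_def Let_def field_simps)
qed

lemma half_turn_high:
  assumes "6 * of_int i - 1 \<le> t" "t < 6 * of_int i"
  shows "half_turn t = 5 * t - 24 * of_int i + 5"
proof -
  have "\<lfloor>t / 6\<rfloor> = i - 1" using assms by linarith
  then show ?thesis using assms by (simp add: half_turn_def Let_def field_simps)
qed

lemma half_turn_cases [case_names low high]:
  fixes t :: real
  obtains (low) i :: int where "6 * of_int i \<le> t" "t < 6 * of_int i + 5"
    | (high) i :: int where "6 * of_int i - 1 \<le> t" "t < 6 * of_int i"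
proof -
  define i where "i = \<lfloor>t / 6\<rfloor>"
  have i: "6 * of_int i \<le> t" "t < 6 * of_int i + 6"
    unfolding i_def by linarith+
  show thesis
  proof (cases "t < 6 * of_int i + 5")
    case True
    then show thesis using low i by blast
  next
    case False
    then show thesis using high [of "i + 1"] i by simp
  qed
qed

lemma half_turn_half_turn: "half_turn (half_turn t) = t + 6"
proof (cases t rule: half_turn_cases)
  case (low i)
  have "half_turn (half_turn t) = 5 * half_turn t - 24 * of_int (i + 1) + 5"
    using low by (intro half_turn_high) (simp_all add: half_turn_low)
  also have "\<dots> = t + 6"
    unfolding half_turn_low [OF low] by (simp add: field_simps)
  finally show ?thesis .
next
  case (high i)
  have "half_turn (half_turn t) = half_turn t / 5 + 24 / 5 * of_int i + 5"
    using high by (intro half_turn_low) (simp_all add: half_turn_high)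
  also have "\<dots> = t + 6"
    unfolding half_turn_high [OF high] by (simp add: field_simps)
  finally show ?thesis .
qed

lemma half_turn_shift: "half_turn (t + 6 * of_int j) = half_turn t + 6 * of_int j"
proof (cases t rule: half_turn_cases)
  case (low i)
  then have "half_turn (t + 6 * of_int j) =
      (t + 6 * of_int j) / 5 + 24 / 5 * of_int (i + j) + 5"
    by (intro half_turn_low) simp_all
  then show ?thesis using half_turn_low [OF low] by (simp add: field_simps)
next
  case (high i)
  then have "half_turn (t + 6 * of_int j) =
      5 * (t + 6 * of_int j) - 24 * of_int (i + j) + 5"
    by (intro half_turn_high) simp_all
  then show ?thesis using high by (simp add: half_turn_high)
qed

lemma strict_mono_half_turn: "strict_mono half_turn"
proof (rule strict_monoI)
  fix t t' :: real
  assume "t < t'"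
  have int: "i \<le> j" if "of_int i < of_int j + (1::real)" for i j :: int
    using that by linarith
  show "half_turn t < half_turn t'"
  proof (cases t rule: half_turn_cases; cases t' rule: half_turn_cases)
    fix i j :: int
    assume *: "6 * of_int i \<le> t" "t < 6 * of_int i + 5" "6 * of_int j \<le> t'" "t' < 6 * of_int j + 5"
    then have "i \<le> j" using \<open>t < t'\<close> by linarith
    then have "i = j \<or> i + 1 \<le> j" by linarith
    then have "of_int i = (of_int j :: real) \<or> of_int i + 1 \<le> (of_int j :: real)"
      by (elim disjE) (simp, linarith)
    then show ?thesis
      using * \<open>t < t'\<close> half_turn_low [OF *(1,2)] half_turn_low [OF *(3,4)]
      by (elim disjE) linarith+
  next
    fix i j :: int
    assume *: "6 * of_int i \<le> t" "t < 6 * of_int i + 5" "6 * of_int j - 1 \<le> t'" "t' < 6 * of_int j"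
    then have "i + 1 \<le> j" using \<open>t < t'\<close> by linarith
    then have "of_int i + 1 \<le> (of_int j :: real)" by linarith
    then show ?thesis
      using * \<open>t < t'\<close> half_turn_low [OF *(1,2)] half_turn_high [OF *(3,4)] by linarith
  next
    fix i j :: int
    assume *: "6 * of_int i - 1 \<le> t" "t < 6 * of_int i" "6 * of_int j \<le> t'" "t' < 6 * of_int j + 5"
    then have "i \<le> j" using \<open>t < t'\<close> by linarith
    then have "of_int i \<le> (of_int j :: real)" by linarith
    then show ?thesis
      using * \<open>t < t'\<close> half_turn_high [OF *(1,2)] half_turn_low [OF *(3,4)] by linarith
  next
    fix i j :: int
    assume *: "6 * of_int i - 1 \<le> t" "t < 6 * of_int i" "6 * of_int j - 1 \<le> t'" "t' < 6 * of_int j"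
    then have "i \<le> j" using \<open>t < t'\<close> by linarith
    then have "i = j \<or> i + 1 \<le> j" by linarith
    then have "of_int i = (of_int j :: real) \<or> of_int i + 1 \<le> (of_int j :: real)"
      by (elim disjE) (simp, linarith)
    then show ?thesis
      using * \<open>t < t'\<close> half_turn_high [OF *(1,2)] half_turn_high [OF *(3,4)]
      by (elim disjE) linarith+
  qed
qed

section \<open>The ping-pong actions and their orders\<close>

text \<open>The shifts by \<open>18n\<close> and \<open>12n\<close> are compatible with \<open>x\<^sup>2 = y\<^sup>3\<close> because \<open>2 \<cdot> 18 = 3 \<cdot> 12\<close>.\<close>

locale trefoil_action = trefoil_group +
  fixes n :: int and \<rho> :: "'a \<Rightarrow> real \<Rightarrow> real"
  assumes n_nonneg: "0 \<le> n"
    and action_mult: "g \<in> carrier G \<Longrightarrow> h \<in> carrier G \<Longrightarrow> \<rho> (g \<otimes> h) t = \<rho> g (\<rho> h t)"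
    and action_mono: "g \<in> carrier G \<Longrightarrow> strict_mono (\<rho> g)"
    and action_x: "\<rho> x t = half_turn t + 18 * of_int n"
    and action_y: "\<rho> y t = t + 2 + 12 * of_int n"
begin

abbreviation k where "k \<equiv> 6 * n + 1"

definition pos where "pos g = \<rho> g 0"

lemma action_one [simp]: "\<rho> \<one> t = t"
proof -
  have "\<rho> \<one> (\<rho> \<one> t) = \<rho> \<one> t"
    using action_mult [of \<one> \<one> t] by simp
  then show ?thesis
    using strict_mono_eq [OF action_mono [of \<one>]] by simp
qed

lemma pos_one [simp]: "pos \<one> = 0"
  by (simp add: pos_def)

lemma pos_mult: "g \<in> carrier G \<Longrightarrow> h \<in> carrier G \<Longrightarrow> pos (g \<otimes> h) = \<rho> g (pos h)"
  by (simp add: pos_def action_mult)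

lemma action_z: "\<rho> z t = t + 6 * of_int k"
  using half_turn_shift [of "half_turn t" "3 * n"]
  by (simp add: z_def action_mult action_x half_turn_half_turn)

lemma action_zpow: "\<rho> (z [^] (j::int)) t = t + 6 * of_int (j * k)"
proof (induction j rule: int_induct [where k = 0])
  case base
  then show ?case by simp
next
  case (step1 j)
  have "z [^] (j + 1) = z [^] j \<otimes> z"
    using int_pow_mult [of z j 1] by simp
  then have "\<rho> (z [^] (j + 1)) t = \<rho> z (\<rho> (z [^] j) t)"
    by (simp add: action_mult z_comm)
  then show ?case using step1 by (simp add: action_z algebra_simps)
next
  case (step2 j)
  have "z [^] j = z [^] (j - 1) \<otimes> z"
    using int_pow_mult [of z "j - 1" 1] by simp
  then have "\<rho> (z [^] j) t = \<rho> z (\<rho> (z [^] (j - 1)) t)"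
    by (simp add: action_mult z_comm)
  then show ?case using step2 by (simp add: action_z algebra_simps)
qed

lemma pos_y: "g \<in> carrier G \<Longrightarrow> pos (y \<otimes> g) = pos g + 2 + 12 * of_int n"
  by (simp add: pos_mult action_y)

lemma pos_x_low:
  assumes "g \<in> carrier G" "6 * of_int i \<le> pos g" "pos g < 6 * of_int i + 5"
  shows "6 * of_int (i + 3 * n + 1) - 1 \<le> pos (x \<otimes> g)" "pos (x \<otimes> g) < 6 * of_int (i + 3 * n + 1)"
  using assms by (auto simp: pos_mult action_x half_turn_low)

text \<open>Ping-pong: an element whose normal form starts with \<open>x\<close> moves the base point into an \<open>X\<close> arc,
  and one that starts with \<open>y\<close> into a \<open>Y\<close> arc. All but the central elements avoid the left end of a \<open>Y\<close> arc, and this yields the trivial stabiliser.\<close>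

lemma pos_initial:
  "g \<in> x_initial \<Longrightarrow> \<exists>i. 6 * of_int i - 1 \<le> pos g \<and> pos g < 6 * of_int i"
  "g \<in> y_initial \<Longrightarrow> (\<exists>j. g = z [^] (j::int)) \<or> (\<exists>i. 6 * of_int i < pos g \<and> pos g < 6 * of_int i + 5)"
proof (induction rule: x_initial_y_initial.inducts)
  case (central j)
  then show ?case by blast
next
  case (x g)
  have g: "g \<in> carrier G" using x initial_closed by blast
  from x.IH(2) obtain i where "6 * of_int i \<le> pos g" "pos g < 6 * of_int i + 5"
  proof
    assume "\<exists>j. g = z [^] (j::int)"
    then obtain j where j: "g = z [^] (j::int)" ..
    show ?thesis using that [of "j * k"] by (simp add: j pos_def action_zpow)
  next
    assume "\<exists>i. 6 * of_int i < pos g \<and> pos g < 6 * of_int i + 5"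
    then show ?thesis using that by (meson less_imp_le)
  qed
  then show ?case using pos_x_low [OF g] by blast
next
  case (y g)
  have g: "g \<in> carrier G" using y initial_closed by blast
  from y.IH obtain i where "6 * of_int i - 1 \<le> pos g" "pos g < 6 * of_int i" by blast
  then show ?case by (intro disjI2 exI [of _ "i + 2 * n"]) (simp add: pos_y g)
next
  case (yy g)
  have g: "g \<in> carrier G" using yy initial_closed by blast
  from yy.IH obtain i where "6 * of_int i - 1 \<le> pos g" "pos g < 6 * of_int i" by blast
  then show ?case by (intro disjI2 exI [of _ "i + 4 * n"]) (simp add: pos_y g)
next
  case (y_central j)
  show ?case
    by (intro disjI2 exI [of _ "j * k + 2 * n"]) (simp add: pos_y pos_def [of "z [^] j"] action_zpow)
next
  case (yy_central j)
  show ?case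
    by (intro disjI2 exI [of _ "j * k + 4 * n"]) (simp add: pos_y pos_def [of "z [^] j"] action_zpow)
qed

lemma pos_eq_0_iff:
  assumes "g \<in> carrier G"
  shows "pos g = 0 \<longleftrightarrow> g = \<one>"
proof
  assume 0: "pos g = 0"
  from normal_form [OF assms] show "g = \<one>"
  proof
    assume "g \<in> x_initial"
    then obtain i :: int where "6 * of_int i - 1 \<le> (0::real)" "(0::real) < 6 * of_int i"
      using pos_initial(1) 0 by metis
    then have "0 < i" "i < 1" by linarith+
    then show ?thesis by linarith
  next
    assume "g \<in> y_initial"
    then consider j where "g = z [^] (j::int)" | i :: int where "6 * of_int i < (0::real)" "(0::real) < 6 * of_int i + 5"
      using pos_initial(2) 0 by metis
    then show ?thesis
    proof cases
      case 1
      then have "of_int (j * k) = (0::real)" using 0 by (simp add: pos_def action_zpow)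
      then have "j * k = 0" by (simp only: of_int_eq_0_iff)
      then show ?thesis using 1 n_nonneg by simp
    next
      case 2
      then have "i < 0" "-1 < i" by linarith+
      then show ?thesis by linarith
    qed
  qed
qed simp

definition ord :: "('a \<times> 'a) set" where
  "ord = {(f, g) \<in> carrier G \<times> carrier G. pos f < pos g}"

lemma pos_inj:
  assumes "f \<in> carrier G" "g \<in> carrier G" "pos f = pos g"
  shows "f = g"
proof -
  have "\<rho> f (pos (inv f \<otimes> g)) = \<rho> f 0"
    using assms by (simp add: pos_mult [symmetric] m_assoc [symmetric]) (simp add: pos_def)
  then have "pos (inv f \<otimes> g) = 0"
    using strict_mono_eq [OF action_mono [OF assms(1)]] by simp
  then show ?thesis
    using assms by (metis pos_eq_0_iff inv_closed m_closed inv_equality inv_inv)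
qed

lemma ord_left_ordered: "left_ordered_group G (\<lambda>f g. (f, g) \<in> ord)"
proof unfold_locales
  fix f g h assume "f \<in> carrier G" "g \<in> carrier G" "h \<in> carrier G" "(f, g) \<in> ord"
  then show "(h \<otimes> f, h \<otimes> g) \<in> ord"
    using strict_mono_less [OF action_mono] by (simp add: ord_def pos_mult)
qed (use pos_inj in \<open>force simp: ord_def\<close>)+

lemma ord_left_orders: "ord \<in> left_orders G"
proof -
  interpret left_ordered_group G "\<lambda>f g. (f, g) \<in> ord"
    by (rule ord_left_ordered)
  show ?thesis
    unfolding left_orders_def
    by (auto simp: irrefl_def total_on_def intro!: transI mult_less)
      (auto simp: ord_def dest: pos_inj)
qed

lemma action_u:
  assumes "6 * of_int i \<le> t" "t < 6 * of_int i + 5"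
  shows "6 * of_int (i + 5 * n + 1) + 1 \<le> \<rho> u t" "\<rho> u t < 6 * of_int (i + 5 * n + 1) + 2"
  using assms by (auto simp: u_def action_mult action_x action_y half_turn_low)

text \<open>The bound is far smaller than the arc length 5: the images of the base point under powers of \<open>yx\<close>
  stay near the left ends of the arcs. This is what makes \<open>y\<close> keep markers in \<open>Y\<close> arcs.\<close>

lemma pos_upow:
  "6 * of_int (int m * (5 * n + 1)) \<le> pos (u [^] m) \<and> pos (u [^] m) < 6 * of_int (int m * (5 * n + 1)) + 2
    \<and> (0 < m \<longrightarrow> 6 * of_int (int m * (5 * n + 1)) + 1 \<le> pos (u [^] m))"
proof (induction m)
  case 0
  then show ?case by simp
next
  case (Suc m)
  have "pos (u [^] Suc m) = \<rho> u (pos (u [^] m))"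
    using pos_mult [of u "u [^] m"] by (metis nat_pow_Suc2 nat_pow_closed u_closed)
  moreover have "int (Suc m) * (5 * n + 1) = int m * (5 * n + 1) + 5 * n + 1"
    by (simp add: algebra_simps)
  ultimately show ?case
    using Suc action_u [of "int m * (5 * n + 1)" "pos (u [^] m)"] by auto
qed

lemma pos_mult_zpow: "g \<in> carrier G \<Longrightarrow> pos (g \<otimes> z [^] (j::int)) = pos g + 6 * of_int (j * k)"
  by (simp add: zpow_comm pos_mult action_zpow)

lemma pos_marker: "6 * of_int i \<le> pos (marker n i)" "pos (marker n i) < 6 * of_int i + 2"
proof -
  define m where "m = nat (6 * i mod k)"
  define a where "a = (i - (6 * i mod k) * (5 * n + 1)) div k"
  have k: "0 < k" using n_nonneg by simp
  then have m: "int m = 6 * i mod k" by (simp add: m_def)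
  then have eq: "marker n i = u [^] m \<otimes> z [^] a"
    by (metis marker_def a_def int_pow_int)
  have "i = int m * (5 * n + 1) + a * k"
    unfolding a_def m by (rule marker_index [OF n_nonneg])
  then have i: "real_of_int i = of_int (int m * (5 * n + 1)) + of_int (a * k)"
    by (metis of_int_add)
  show "6 * of_int i \<le> pos (marker n i)" "pos (marker n i) < 6 * of_int i + 2"
    using conjunct1 [OF pos_upow [of m]] conjunct1 [OF conjunct2 [OF pos_upow [of m]]]
    unfolding eq i pos_mult_zpow [OF nat_pow_closed [OF u_closed]]
    by (simp_all add: distrib_left del: of_int_mult of_int_add)
qed

lemma pos_least_pos: "1 \<le> pos (least_pos n)" "pos (least_pos n) < 2"
proof -
  have eq: "least_pos n = u [^] nat k \<otimes> z [^] (- (5 * n + 1))"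
    using n_nonneg by (simp add: least_pos_def int_pow_int [symmetric])
  have k: "int (nat k) = k" "0 < nat k" using n_nonneg by auto
  show "1 \<le> pos (least_pos n)" "pos (least_pos n) < 2"
    using pos_upow [of "nat k"] k(2) unfolding eq k(1)
    by (simp_all add: pos_mult_zpow algebra_simps)
qed

lemma pos_x_marker:
  "6 * of_int (i + 3 * n + 1) - 1 \<le> pos (x \<otimes> marker n i)" "pos (x \<otimes> marker n i) < 6 * of_int (i + 3 * n + 1)"
  using pos_x_low [of "marker n i" i] pos_marker [of i] by auto

lemma ord_marked: "marked_trefoil_order G x y (\<lambda>f g. (f, g) \<in> ord) n"
proof -
  interpret left_ordered_group G "\<lambda>f g. (f, g) \<in> ord"
    by (rule ord_left_ordered)
  show ?thesis
  proof
    show "0 \<le> n" by (rule n_nonneg)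
    show "(marker n i, x \<otimes> marker n (i - 3 * n)) \<in> ord" for i
      using pos_marker [of i] pos_x_marker [of "i - 3 * n"] by (simp add: ord_def)
    show "(y \<otimes> marker n i, x \<otimes> marker n (i - n)) \<in> ord" for i
      using pos_marker [of i] pos_x_marker [of "i - n"] by (simp add: ord_def pos_y)
    show "(y \<otimes> y, x \<otimes> marker n n) \<in> ord"
      using pos_y [of y] pos_y [of \<one>] pos_x_marker [of n] by (simp add: ord_def)
    show "(\<one>, least_pos n) \<in> ord"
      using pos_least_pos by (simp add: ord_def)
  qed
qed

end

section \<open>The orders are isolated and discrete\<close>

context trefoil_action
begin

text \<open>The heart of the argument. The same index \<open>i\<close> locates an element on the line and between the
  markers of an arbitrary marked order, because multiplication by a letter changes both
  locations in the same way.\<close>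

lemma between_markers:
  assumes "marked_trefoil_order G x y lt n"
  shows "g \<in> x_initial \<Longrightarrow> \<exists>i. 6 * of_int i - 1 \<le> pos g \<and> pos g < 6 * of_int i \<and>
      left_ordered_group.le lt (x \<otimes> marker n (i - 3 * n - 1)) g \<and> lt g (marker n i)"
    and "g \<in> y_initial \<Longrightarrow> \<exists>i. 6 * of_int i \<le> pos g \<and> pos g < 6 * of_int i + 5 \<and>
      left_ordered_group.le lt (marker n i) g \<and> lt g (x \<otimes> marker n (i - 3 * n))"
proof (induction rule: x_initial_y_initial.inducts)
  interpret M: marked_trefoil_order G x y lt n by fact
  {
    case (central j)
    show ?case
      using M.marker_less_x [of "j * k"] M.marker_zpow [of j]
      by (intro exI [of _ "j * k"]) (simp add: pos_def action_zpow)
  next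
    case (x g)
    have g: "g \<in> carrier G" using x initial_closed by blast
    from x.IH(2) obtain i where i: "6 * of_int i \<le> pos g" "pos g < 6 * of_int i + 5"
      and l: "M.le (M.s i) g" "lt g (x \<otimes> M.s (i - 3 * n))" by blast
    have "M.le (x \<otimes> M.s i) (x \<otimes> g)"
      by (intro M.mult_le l g) auto
    moreover have "lt (x \<otimes> g) (M.s (i + 3 * n + 1))"
      using M.mult_less [OF _ _ _ l(2), of x] g M.marker_shift [of "i - 3 * n"]
      by (simp add: xx_mult algebra_simps)
    ultimately show ?case
      using pos_x_low [OF g i] by (intro exI [of _ "i + 3 * n + 1"]) simp
  next
    case (y g)
    have g: "g \<in> carrier G" using y initial_closed by blast
    from y.IH(2) obtain i where i: "6 * of_int i - 1 \<le> pos g" "pos g < 6 * of_int i"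
      and l: "M.le (x \<otimes> M.s (i - 3 * n - 1)) g" "lt g (M.s i)" by blast
    show ?case
      using i M.y_step [OF g l(1) M.less_imp_le [OF l(2)]]
      by (intro exI [of _ "i + 2 * n"]) (simp add: pos_y g)
  next
    case (yy g)
    have g: "g \<in> carrier G" using yy initial_closed by blast
    from yy.IH(2) obtain i where i: "6 * of_int i - 1 \<le> pos g" "pos g < 6 * of_int i"
      and l: "M.le (x \<otimes> M.s (i - 3 * n - 1)) g" "lt g (M.s i)" by blast
    have "lt (y \<otimes> (y \<otimes> g)) (y \<otimes> (y \<otimes> M.s i))"
      using g l(2) by (intro M.mult_less) auto
    also have "M.le \<dots> (x \<otimes> M.s (i + n))"
      by (rule M.yy_marker_le)
    finally show ?case
      using i M.yy_lower [OF g l(1)]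
      by (intro exI [of _ "i + 4 * n"]) (simp add: pos_y g add.commute [of i n])
  next
    case (y_central j)
    have "M.le (x \<otimes> M.s (j * k - 3 * n - 1)) (z [^] j)"
      using M.x_marker_less [of "j * k"] M.marker_zpow [of j] by (simp add: M.less_imp_le)
    then show ?case
      using M.y_step [of "z [^] j" "j * k"] M.marker_zpow [of j]
      by (intro exI [of _ "j * k + 2 * n"]) (simp add: pos_y pos_def [of "z [^] j"] action_zpow)
  next
    case (yy_central j)
    have "M.le (x \<otimes> M.s (j * k - 3 * n - 1)) (z [^] j)"
      using M.x_marker_less [of "j * k"] M.marker_zpow [of j] by (simp add: M.less_imp_le)
    then show ?case
      using M.yy_lower [of "z [^] j" "j * k"] M.yy_zpow_less [of j]
      by (intro exI [of _ "j * k + 4 * n"]) (simp add: add.commute [of "j * k" n] pos_y pos_def [of "z [^] j"] action_zpow)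
  }
qed

text \<open>A positive element lies in \<open>Y\<^sub>0\<close> or in an arc to the right of it, and the left ends of these arcs
  are at least \<open>s\<^sub>0 = 1\<close>.\<close>

lemma positive_if_marked:
  assumes "marked_trefoil_order G x y lt n" and g: "g \<in> carrier G" "0 < pos g"
  shows "lt \<one> g"
proof -
  interpret M: marked_trefoil_order G x y lt n by fact
  have s: "M.le \<one> (M.s i)" if "0 \<le> i" for i
    using M.marker_strict_mono [of 0 i] that by (cases "i = 0") (auto simp: M.le_def)
  from normal_form [OF g(1)] show ?thesis
  proof
    assume "g \<in> x_initial"
    from between_markers(1) [OF assms(1) this] obtain i where i: "pos g < 6 * of_int i"
      and l: "M.le (x \<otimes> M.s (i - 3 * n - 1)) g" by blast
    have "0 \<le> i - 1" using i g(2) by linarith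
    then have "M.le \<one> (M.s (i - 1))" by (rule s)
    also have "lt \<dots> (x \<otimes> M.s (i - 3 * n - 1))"
      using M.marker_less_x [of "i - 1"] by (simp add: algebra_simps)
    also note l
    finally show ?thesis .
  next
    assume "g \<in> y_initial"
    from between_markers(2) [OF assms(1) this] obtain i where i: "pos g < 6 * of_int i + 5"
      and l: "M.le (M.s i) g" by blast
    have "0 \<le> i" using i g(2) by linarith
    then have "M.le \<one> (M.s i)" by (rule s)
    also note l
    finally show ?thesis using g(2) by (auto simp: M.le_def)
  qed
qed

text \<open>Multiplying by a power of \<open>z\<close> shifts the index of a marker by a multiple of \<open>6n + 1\<close>, so one
  period of indices suffices.\<close>

definition witnesses where
  "witnesses = (\<lambda>i. inv (marker n i) \<otimes> (x \<otimes> marker n (i - 3 * n))) ` {0..<k}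
    \<union> (\<lambda>i. inv (y \<otimes> marker n i) \<otimes> (x \<otimes> marker n (i - n))) ` {0..<k}
    \<union> {inv (y \<otimes> y) \<otimes> (x \<otimes> marker n n), least_pos n}"

lemma witnesses_closed: "witnesses \<subseteq> carrier G"
  by (auto simp: witnesses_def)

lemma ord_witnesses:
  assumes "f \<in> witnesses"
  shows "(\<one>, f) \<in> ord"
proof -
  interpret M: marked_trefoil_order G x y "\<lambda>f g. (f, g) \<in> ord" n by (rule ord_marked)
  show ?thesis
    using assms M.marker_less_x M.y_marker_less_x M.yy_less_x M.least_pos_pos
    by (auto simp: witnesses_def M.one_less_quotient)
qed

lemma marked_if_witnesses:
  assumes r: "left_ordered_group G lt" and w: "\<And>f. f \<in> witnesses \<Longrightarrow> lt \<one> f"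
  shows "marked_trefoil_order G x y lt n"
proof -
  interpret L: left_ordered_group G lt by fact
  have shift: "marker n (i + j * k) = z [^] j \<otimes> marker n i" for i j
    by (rule marker_add_mult_period [OF n_nonneg])
  have k: "0 < k" using n_nonneg by simp
  have i: "0 \<le> i mod k" "i mod k < k" for i
    using k by (simp_all only: pos_mod_sign pos_mod_bound)
  have eq: "i mod k + i div k * k = i" "i mod k - c + i div k * k = i - c" for i c
    by (simp_all only: diff_add_eq mod_div_mult_eq)
  show ?thesis
  proof
    show "0 \<le> n" by (rule n_nonneg)
    show "lt (marker n i) (x \<otimes> marker n (i - 3 * n))" for i
    proof -
      have "inv (marker n (i mod k)) \<otimes> (x \<otimes> marker n (i mod k - 3 * n)) \<in> witnesses"
        unfolding witnesses_def using i [of i] by (intro UnI1 UnI1 imageI) simp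
      from w [OF this] have "lt (marker n (i mod k)) (x \<otimes> marker n (i mod k - 3 * n))"
        by (subst (asm) L.one_less_quotient) auto
      then have "lt (z [^] (i div k) \<otimes> marker n (i mod k))
          (z [^] (i div k) \<otimes> (x \<otimes> marker n (i mod k - 3 * n)))"
        by (intro L.mult_less) auto
      then show ?thesis
        by (simp only: zpow_mult_letter marker_closed shift [symmetric] eq)
    qed
    show "lt (y \<otimes> marker n i) (x \<otimes> marker n (i - n))" for i
    proof -
      have "inv (y \<otimes> marker n (i mod k)) \<otimes> (x \<otimes> marker n (i mod k - n)) \<in> witnesses"
        unfolding witnesses_def using i [of i] by (intro UnI1 [OF UnI2] imageI) simp
      from w [OF this] have "lt (y \<otimes> marker n (i mod k)) (x \<otimes> marker n (i mod k - n))"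
        by (subst (asm) L.one_less_quotient) auto
      then have "lt (z [^] (i div k) \<otimes> (y \<otimes> marker n (i mod k)))
          (z [^] (i div k) \<otimes> (x \<otimes> marker n (i mod k - n)))"
        by (intro L.mult_less) auto
      then show ?thesis
        by (simp only: zpow_mult_letter marker_closed shift [symmetric] eq)
    qed
    show "lt (y \<otimes> y) (x \<otimes> marker n n)"
      using w [of "inv (y \<otimes> y) \<otimes> (x \<otimes> marker n n)"]
      by (simp add: witnesses_def L.one_less_quotient)
    show "lt \<one> (least_pos n)"
      by (rule w) (simp add: witnesses_def)
  qed
qed

theorem isolated_ord: "isolated_left_order G ord"
proof (rule isolated_if_finitely_determined)
  show "ord \<in> left_orders G" by (rule ord_left_orders)
  show "finite witnesses" by (simp add: witnesses_def)
  show "witnesses \<subseteq> carrier G" by (rule witnesses_closed)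
  show "(\<one>, f) \<in> ord" if "f \<in> witnesses" for f
    using that by (rule ord_witnesses)
  fix r' assume r': "r' \<in> left_orders G" and w: "\<And>f. f \<in> witnesses \<Longrightarrow> (\<one>, f) \<in> r'"
  interpret L: left_ordered_group G "\<lambda>f g. (f, g) \<in> r'"
    by (rule left_orders_left_ordered_group [OF is_group r'])
  interpret O: left_ordered_group G "\<lambda>f g. (f, g) \<in> ord"
    by (rule ord_left_ordered)
  have marked: "marked_trefoil_order G x y (\<lambda>f g. (f, g) \<in> r') n"
    using L.left_ordered_group_axioms w by (rule marked_if_witnesses)
  show "ord \<subseteq> r'"
  proof
    fix p assume p: "p \<in> ord"
    then obtain f g where fg: "p = (f, g)" "f \<in> carrier G" "g \<in> carrier G"
      by (auto simp: ord_def)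
    then have "(\<one>, inv f \<otimes> g) \<in> ord" using p by (simp add: O.one_less_quotient)
    then have "0 < pos (inv f \<otimes> g)" by (simp add: ord_def)
    from positive_if_marked [OF marked _ this] show "p \<in> r'"
      using fg by (simp add: L.one_less_quotient)
  qed
qed

text \<open>A positive element moves the base point by at least 2
  except when its normal form is \<open>y h\<close> with \<open>h\<close> in the arc \<open>X\<^sub>-\<^sub>2\<^sub>n\<close>; in this case the bound of \<open>h\<close>
  by its marker is, after multiplication by \<open>y\<close>, the claim.\<close>

lemma least_pos_least:
  assumes g: "g \<in> carrier G" "0 < pos g"
  shows "pos (least_pos n) \<le> pos g"
proof -
  interpret M: marked_trefoil_order G x y "\<lambda>f g. (f, g) \<in> ord" n by (rule ord_marked)
  have large: ?thesis if "2 \<le> pos g"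
    using that pos_least_pos by linarith
  have integral: ?thesis if "pos g = 6 * of_int m + of_int c" "c \<in> {0, 2, 4}" for m c :: int
  proof (rule large)
    have "0 < 6 * m + c" using that(1) g(2) by linarith
    then have "2 \<le> 6 * m + c" using that(2) by auto
    then show "2 \<le> pos g" using that(1) by linarith
  qed
  from normal_form [OF g(1)] show ?thesis
  proof
    assume "g \<in> x_initial"
    then obtain i :: int where i: "6 * of_int i - 1 \<le> pos g" "pos g < 6 * of_int i"
      using pos_initial(1) by blast
    then have "1 \<le> i" using g(2) by linarith
    then show ?thesis using large i by linarith
  next
    assume "g \<in> y_initial"
    then show ?thesis
    proof cases
      case (central j)
      then show ?thesis using integral [of "j * k" 0] by (simp add: pos_def action_zpow)
    next
      case (y h)
      then have h: "h \<in> carrier G" using initial_closed by blast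
      from between_markers(1) [OF ord_marked y(2)] obtain i where
        i: "6 * of_int i - 1 \<le> pos h" "pos h < 6 * of_int i"
        and l: "M.le (x \<otimes> M.s (i - 3 * n - 1)) h" by blast
      show ?thesis
      proof (cases "i + 2 * n = 0")
        case False
        have "0 \<le> i + 2 * n" using i g(2) unfolding y(1) pos_y [OF h] by linarith
        then have "1 \<le> i + 2 * n" using False by linarith
        then have "2 \<le> pos g" using i unfolding y(1) pos_y [OF h] by linarith
        then show ?thesis by (rule large)
      next
        case True
        define i' where "i' = - 5 * n - 1"
        have i': "i - 3 * n - 1 = i'" "i' + 5 * n + 1 = 0" using True by (simp_all add: i'_def)
        have "1 \<le> pos (u \<otimes> M.s i')"
          using action_u(1) [of i' "pos (M.s i')"] pos_marker [of i'] i'(2)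
          by (simp add: pos_mult)
        then have "u \<otimes> M.s i' \<noteq> \<one>" by auto
        then have "u \<otimes> M.s i' = least_pos n"
          using u_marker [OF n_nonneg, of i'] unfolding i'(2) by auto
        moreover have "M.le (y \<otimes> (x \<otimes> M.s i')) g"
          unfolding y(1) using l h by (intro M.mult_le) (auto simp: i')
        ultimately have "M.le (least_pos n) g" by (simp add: u_def m_assoc)
        then show ?thesis unfolding M.le_def by (auto simp: ord_def)
      qed
    next
      case (yy h)
      then have h: "h \<in> carrier G" using initial_closed by blast
      from pos_initial(1) [OF yy(2)] obtain i :: int where
        i: "6 * of_int i - 1 \<le> pos h" "pos h < 6 * of_int i" by blast
      have p: "pos g = pos h + 4 + 24 * of_int n" by (simp add: yy(1) pos_y h)
      have "0 \<le> i + 4 * n" using i g(2) unfolding p by linarith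
      then have "2 \<le> pos g" using i unfolding p by linarith
      then show ?thesis by (rule large)
    next
      case (y_central j)
      then show ?thesis using integral [of "j * k + 2 * n" 2]
        by (simp add: pos_y pos_def [of "z [^] j"] action_zpow)
    next
      case (yy_central j)
      then show ?thesis using integral [of "j * k + 4 * n" 4]
        by (simp add: pos_y pos_def [of "z [^] j"] action_zpow)
    qed
  qed
qed

lemma least_pos_unique:
  assumes "b \<in> carrier G" "(\<one>, b) \<in> ord" "\<And>g. (\<one>, g) \<in> ord \<Longrightarrow> g = b \<or> (b, g) \<in> ord"
  shows "b = least_pos n"
proof -
  have "pos (least_pos n) \<le> pos b"
    using assms(1,2) by (intro least_pos_least) (auto simp: ord_def)
  moreover have "(\<one>, least_pos n) \<in> ord"
    using pos_least_pos by (simp add: ord_def)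
  ultimately show ?thesis
    using assms(3) [of "least_pos n"] by (auto simp: ord_def)
qed

end

section \<open>Roots of unipotent matrices\<close>

type_synonym mat2 = "int \<times> int \<times> int \<times> int"

text \<open>The tuple \<open>(a, b, c, d)\<close> stands for the matrix with rows \<open>a b\<close> and \<open>c d\<close>.\<close>

definition SL2Z :: "mat2 monoid" where
  "SL2Z = \<lparr>carrier = {(a, b, c, d). a * d - b * c = 1},
     monoid.mult = (\<lambda>(a, b, c, d) (a', b', c', d').
       (a * a' + b * c', a * b' + b * d', c * a' + d * c', c * b' + d * d')),
     one = (1, 0, 0, 1)\<rparr>"

lemma carrier_SL2Z [simp]: "(a, b, c, d) \<in> carrier SL2Z \<longleftrightarrow> a * d - b * c = 1"
  and mult_SL2Z [simp]: "(a, b, c, d) \<otimes>\<^bsub>SL2Z\<^esub> (a', b', c', d') =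
    (a * a' + b * c', a * b' + b * d', c * a' + d * c', c * b' + d * d')"
  and one_SL2Z: "\<one>\<^bsub>SL2Z\<^esub> = (1, 0, 0, 1)"
  by (simp_all add: SL2Z_def)

lemma group_SL2Z: "group SL2Z"
proof (rule groupI)
  fix A B assume "A \<in> carrier SL2Z" "B \<in> carrier SL2Z"
  moreover have "(a * a' + b * c') * (c * b' + d * d') - (a * b' + b * d') * (c * a' + d * c') =
      (a * d - b * c) * (a' * d' - b' * c')" for a b c d a' b' c' d' :: int
    by (simp add: algebra_simps)
  ultimately show "A \<otimes>\<^bsub>SL2Z\<^esub> B \<in> carrier SL2Z"
    by (cases A, cases B) simp
next
  fix A assume A: "A \<in> carrier SL2Z"
  obtain a b c d where abcd: "A = (a, b, c, d)" by (cases A)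
  show "\<exists>B\<in>carrier SL2Z. B \<otimes>\<^bsub>SL2Z\<^esub> A = \<one>\<^bsub>SL2Z\<^esub>"
    using A by (intro bexI [of _ "(d, - b, - c, a)"]) (simp_all add: abcd one_SL2Z algebra_simps)
next
  fix A B C assume "A \<in> carrier SL2Z" "B \<in> carrier SL2Z" "C \<in> carrier SL2Z"
  show "A \<otimes>\<^bsub>SL2Z\<^esub> B \<otimes>\<^bsub>SL2Z\<^esub> C = A \<otimes>\<^bsub>SL2Z\<^esub> (B \<otimes>\<^bsub>SL2Z\<^esub> C)"
    by (cases A, cases B, cases C) (simp add: algebra_simps)
qed (auto simp: one_SL2Z)

lemma SL2Z_lower_pow:
  "((a, 0, c, a) :: mat2) [^]\<^bsub>SL2Z\<^esub> (m::nat) = (a ^ m, 0, int m * c * a ^ (m - 1), a ^ m)"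
proof (induction m)
  case 0
  then show ?case by (simp add: one_SL2Z)
next
  case (Suc m)
  then show ?case by (cases m) (simp_all add: algebra_simps)
qed

text \<open>A root commutes with its power, hence is itself lower triangular with equal diagonal entries, and
  its off-diagonal entry gets multiplied by \<open>m\<close> up to sign.\<close>

lemma SL2Z_root_of_unipotent:
  assumes "H \<in> carrier SL2Z" "H [^]\<^bsub>SL2Z\<^esub> (m::nat) = (e, 0, e * q, e)" "e = 1 \<or> e = -1" "q \<noteq> 0"
  shows "int m dvd q"
proof -
  interpret group SL2Z by (rule group_SL2Z)
  obtain a b c d where H: "H = (a, b, c, d)" by (cases H)
  have "H \<otimes>\<^bsub>SL2Z\<^esub> (H [^]\<^bsub>SL2Z\<^esub> m) = (H [^]\<^bsub>SL2Z\<^esub> m) \<otimes>\<^bsub>SL2Z\<^esub> H"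
    using assms(1) by (metis nat_pow_Suc nat_pow_Suc2)
  then have b: "b = 0" and a: "d = a"
    unfolding assms(2) using assms(3,4) by (auto simp: H algebra_simps)
  have "a * a = 1" using assms(1) by (simp add: H a b)
  then have "a = 1 \<or> a = -1" by (simp add: square_eq_1_iff)
  have "e * q = int m * c * a ^ (m - 1)"
    using assms(2) by (simp add: H a b SL2Z_lower_pow)
  then have "int m dvd e * q" by (simp add: mult.assoc)
  then show ?thesis using assms(3) by auto
qed

context trefoil_group
begin

text \<open>Modulo the centre \<open>least_pos m\<close> is a power of \<open>yx\<close> with exponent \<open>6m + 1\<close>, and so its image under
  an automorphism is again such a power modulo the centre.\<close>

lemma least_pos_root_dvd:
  assumes M: "M \<in> hom G SL2Z" "M x = (0, 1, -1, 0)" "M y = (0, -1, 1, 1)"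
    and \<phi>: "\<phi> \<in> iso G G" "\<phi> (least_pos m) = least_pos n" and "0 \<le> m" "0 \<le> n"
  shows "(6 * m + 1) dvd (6 * n + 1)"
proof -
  interpret S: group SL2Z by (rule group_SL2Z)
  interpret M: group_hom G SL2Z M by unfold_locales (rule M)
  have \<phi>_hom: "\<phi> \<in> hom G G" using \<phi> by (simp add: iso_def)
  interpret \<phi>: group_hom G G \<phi> by unfold_locales (rule \<phi>_hom)
  \<comment> \<open>a matrix that commutes with the images of both generators is scalar\<close>
  have scalar: "\<exists>e. (e = 1 \<or> e = -1) \<and> M c = (e, 0, 0, e)"
    if c: "c \<in> carrier G" "\<And>g. g \<in> carrier G \<Longrightarrow> c \<otimes> g = g \<otimes> c" for c
  proof -
    obtain a b a' b' where abab: "M c = (a, b, a', b')" by (cases "M c")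
    have "M c \<otimes>\<^bsub>SL2Z\<^esub> M x = M x \<otimes>\<^bsub>SL2Z\<^esub> M c" "M c \<otimes>\<^bsub>SL2Z\<^esub> M y = M y \<otimes>\<^bsub>SL2Z\<^esub> M c"
      using M.hom_mult [OF c(1) x_closed] M.hom_mult [OF x_closed c(1)] c(2) [OF x_closed]
        M.hom_mult [OF c(1) y_closed] M.hom_mult [OF y_closed c(1)] c(2) [OF y_closed]
      by (metis, metis)
    then have "b = 0 \<and> a' = 0 \<and> b' = a"
      unfolding abab M(2,3) mult_SL2Z prod.inject
      by (elim conjE) (intro conjI; linarith)
    then have "b = 0" "a' = 0" "b' = a" by auto
    moreover from this have "a * a = 1"
      using M.hom_closed [OF c(1)] by (simp add: abab)
    ultimately show ?thesis by (simp add: abab square_eq_1_iff)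
  qed
  have z_central: "z [^] (j::int) \<otimes> g = g \<otimes> z [^] j" if "g \<in> carrier G" for g j
    using that by (simp add: zpow_comm)
  obtain e where e: "e = 1 \<or> e = -1" "M (z [^] (- (5 * n + 1))) = (e, 0, 0, e)"
    using scalar [OF int_pow_closed [OF z_closed], OF z_central] by metis
  have comm: "\<phi> (z [^] (- (5 * m + 1))) \<otimes> g = g \<otimes> \<phi> (z [^] (- (5 * m + 1)))" if "g \<in> carrier G" for g
  proof -
    obtain h where h: "h \<in> carrier G" "g = \<phi> h"
      using \<phi>(1) \<open>g \<in> carrier G\<close> by (auto simp: iso_def bij_betw_def)
    then have "\<phi> (z [^] (- (5 * m + 1)) \<otimes> h) = \<phi> (h \<otimes> z [^] (- (5 * m + 1)))"
      by (simp only: z_central)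
    then show ?thesis using h by (simp only: \<phi>.hom_mult int_pow_closed z_closed)
  qed
  from scalar [OF \<phi>.hom_closed [OF int_pow_closed [OF z_closed]], OF comm]
  obtain e' where e': "e' = 1 \<or> e' = -1" "M (\<phi> (z [^] (- (5 * m + 1)))) = (e', 0, 0, e')"
    by metis
  define H where "H = M (\<phi> u)"
  have H: "H \<in> carrier SL2Z" by (simp add: H_def)
  obtain p q r s where pqrs: "H [^]\<^bsub>SL2Z\<^esub> nat (6 * m + 1) = (p, q, r, s)" by (cases "H [^]\<^bsub>SL2Z\<^esub> nat (6 * m + 1)")
  have nat: "int (nat (6 * m + 1)) = 6 * m + 1" "int (nat (6 * n + 1)) = 6 * n + 1"
    using assms by auto
  have Mu: "M u = (1, 0, -1, 1)" by (simp add: u_def M(2,3))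
  have "M (\<phi> (least_pos m)) = (p, q, r, s) \<otimes>\<^bsub>SL2Z\<^esub> (e', 0, 0, e')"
  proof -
    have "least_pos m = u [^] nat (6 * m + 1) \<otimes> z [^] (- (5 * m + 1))"
      unfolding least_pos_def by (metis int_pow_int nat(1))
    then show ?thesis
      by (simp only: \<phi>.hom_mult \<phi>.hom_nat_pow \<phi>.hom_closed M.hom_mult M.hom_nat_pow
          nat_pow_closed u_closed int_pow_closed z_closed H_def [symmetric] pqrs e'(2))
  qed
  moreover have "M (least_pos n) = (1, 0, - (6 * n + 1), 1) \<otimes>\<^bsub>SL2Z\<^esub> (e, 0, 0, e)"
  proof -
    have "least_pos n = u [^] nat (6 * n + 1) \<otimes> z [^] (- (5 * n + 1))"
      unfolding least_pos_def by (metis int_pow_int nat(2))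
    then show ?thesis
      by (simp only: M.hom_mult M.hom_nat_pow nat_pow_closed u_closed int_pow_closed z_closed
          e(2) Mu SL2Z_lower_pow nat) simp
  qed
  ultimately have "(p, q, r, s) = (e * e', 0, e * e' * (- (6 * n + 1)), e * e')"
    using e(1) e'(1) \<phi>(2) by auto
  then have "int (nat (6 * m + 1)) dvd - (6 * n + 1)"
    using H pqrs e(1) e'(1) assms
    by (intro SL2Z_root_of_unipotent [of H _ "e * e'"]) auto
  then show ?thesis by (simp only: nat(1) dvd_minus_iff)
qed

end

section \<open>The braid group on three strings\<close>

definition order_automorphisms :: "(real \<Rightarrow> real) monoid" where
  "order_automorphisms = \<lparr>carrier = {f. bij f \<and> strict_mono f}, monoid.mult = (\<circ>), one = id\<rparr>"

lemma group_order_automorphisms: "group order_automorphisms"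
proof (rule groupI)
  fix f assume "f \<in> carrier order_automorphisms"
  then have f: "bij f" "strict_mono f" by (simp_all add: order_automorphisms_def)
  have "strict_mono (inv_into UNIV f)"
  proof (rule strict_monoI)
    fix s t :: real assume "s < t"
    then show "inv_into UNIV f s < inv_into UNIV f t"
      using strict_mono_less [OF f(2), of "inv_into UNIV f s" "inv_into UNIV f t"] f(1)
      by (simp add: surj_f_inv_f bij_is_surj)
  qed
  then show "\<exists>g\<in>carrier order_automorphisms.
      g \<otimes>\<^bsub>order_automorphisms\<^esub> f = \<one>\<^bsub>order_automorphisms\<^esub>"
    using f by (intro bexI [of _ "inv_into UNIV f"])
      (auto simp: order_automorphisms_def bij_imp_bij_inv bij_is_inj)
qed (auto simp: order_automorphisms_def bij_comp strict_mono_def bij_id o_assoc)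

abbreviation "braid_relation \<equiv>
  {([(S1, True), (S2, True), (S1, True)], [(S2, True), (S1, True), (S2, True)])}"

abbreviation "braid \<equiv> word_class braid_relation"

abbreviation "braid_x \<equiv> braid [(S1, True), (S2, True), (S1, True)]"
abbreviation "braid_y \<equiv> braid [(S1, True), (S2, True)]"

lemma group_B3: "group B3"
  unfolding B3_def by (rule group_presented_group)

lemma carrier_B3: "carrier B3 = range braid"
  by (simp add: B3_def carrier_presented_group)

lemma mult_B3: "braid v \<otimes>\<^bsub>B3\<^esub> braid w = braid (v @ w)"
  by (simp add: B3_def mult_presented_group)

lemma one_B3: "\<one>\<^bsub>B3\<^esub> = braid []"
  by (simp add: B3_def one_presented_group)

text \<open>The substitution \<open>\<sigma>\<^sub>1 = y\<^sup>-\<^sup>1 x\<close>, \<open>\<sigma>\<^sub>2 = x y\<^sup>-\<^sup>1\<close> turns the braid relation into \<open>x\<^sup>2 = y\<^sup>3\<close>.\<close>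

lemma braid_hom_exists:
  fixes H (structure)
  assumes "group H" "X \<in> carrier H" "Y \<in> carrier H" "X \<otimes> X = Y \<otimes> (Y \<otimes> Y)"
  shows "\<exists>h \<in> hom B3 H. h braid_x = X \<and> h braid_y = Y"
proof -
  interpret group H by fact
  define f where "f g = (case g of S1 \<Rightarrow> inv Y \<otimes> X | S2 \<Rightarrow> X \<otimes> inv Y)" for g
  have f: "range f \<subseteq> carrier H"
    using assms by (auto simp: f_def split: braid_gen.splits)
  have "f S1 \<otimes> f S2 = inv Y \<otimes> (X \<otimes> X) \<otimes> inv Y"
    using assms(2,3) by (simp add: f_def m_assoc)
  also have "\<dots> = Y"
    using assms(3) by (simp add: assms(4) m_assoc [symmetric]) (simp add: m_assoc)
  finally have f12: "f S1 \<otimes> f S2 = Y" .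
  have "Y \<otimes> f S1 = X" "f S2 \<otimes> Y = X"
    using assms(2,3) by (simp_all add: f_def m_assoc) (simp add: m_assoc [symmetric])
  have f_closed: "f S1 \<in> carrier H" "f S2 \<in> carrier H" using f by auto
  have x1: "f S1 \<otimes> (f S2 \<otimes> f S1) = X"
    using \<open>Y \<otimes> f S1 = X\<close> f12 f_closed by (simp add: m_assoc [symmetric])
  have x2: "f S2 \<otimes> (f S1 \<otimes> f S2) = X"
    using \<open>f S2 \<otimes> Y = X\<close> f12 by simp
  have "\<exists>!h. h \<in> hom (presented_group braid_relation) H \<inter> extensional (carrier (presented_group braid_relation)) \<and>
           (\<forall>s. h (braid [(s, True)]) = f s)"
    using f f_closed x1 x2 by (intro presented_group_hom assms(1)) auto
  then obtain h where h: "h \<in> hom B3 H" "\<And>s. h (braid [(s, True)]) = f s"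
    unfolding B3_def by blast
  have mult: "h (braid (v @ w)) = h (braid v) \<otimes> h (braid w)" for v w
    using hom_mult [OF h(1), of "braid v" "braid w"] by (simp add: carrier_B3 mult_B3)
  have "h braid_y = Y"
    using mult [of "[(S1, True)]" "[(S2, True)]"] by (simp add: h f12)
  moreover have "h braid_x = X"
    using mult [of "[(S1, True), (S2, True)]" "[(S1, True)]"] \<open>Y \<otimes> f S1 = X\<close> \<open>h braid_y = Y\<close>
    by (simp add: h)
  ultimately show ?thesis using h by blast
qed

lemma trefoil_group_B3: "trefoil_group B3 braid_x braid_y"
proof -
  interpret group B3 by (rule group_B3)
  have rel: "braid_x = braid [(S2, True), (S1, True), (S2, True)]"
    by (simp add: word_class_eq_iff word_eq.relation)
  let ?g = "generate B3 {braid_x, braid_y}"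
  have c: "braid w \<in> carrier B3" for w by (simp add: carrier_B3)
  have inv: "inv\<^bsub>B3\<^esub> braid w = braid (inv_word w)" for w
    by (rule inv_equality) (simp_all add: c mult_B3 one_B3 word_class_eq_iff word_eq_inv_word)
  have sub: "subgroup ?g B3" by (rule generate_is_subgroup) (simp add: c)
  have xy: "braid_x \<in> ?g" "braid_y \<in> ?g" by (auto intro: generate.incl)
  have "braid_y \<otimes>\<^bsub>B3\<^esub> braid [(S1, True)] = braid_x" by (simp add: mult_B3)
  then have "braid [(S1, True)] = inv\<^bsub>B3\<^esub> braid_y \<otimes>\<^bsub>B3\<^esub> braid_x"
    using inv_solve_left [of "braid [(S1, True)]" braid_y braid_x] c by simp
  then have s1: "braid [(S1, True)] \<in> ?g"
    using xy subgroup.m_closed [OF sub] subgroup.m_inv_closed [OF sub] by simp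
  have "braid [(S2, True)] \<otimes>\<^bsub>B3\<^esub> braid_y = braid_x" by (simp add: mult_B3 rel)
  then have "braid [(S2, True)] = braid_x \<otimes>\<^bsub>B3\<^esub> inv\<^bsub>B3\<^esub> braid_y"
    using inv_solve_right [of "braid [(S2, True)]" braid_x braid_y] c by simp
  then have s2: "braid [(S2, True)] \<in> ?g"
    using xy subgroup.m_closed [OF sub] subgroup.m_inv_closed [OF sub] by simp
  have letter: "braid [(s, b)] \<in> ?g" for s b
  proof -
    have pos: "braid [(s, True)] \<in> ?g" using s1 s2 by (cases s) auto
    then have "inv\<^bsub>B3\<^esub> braid [(s, True)] \<in> ?g" by (rule subgroup.m_inv_closed [OF sub])
    then show ?thesis using pos by (cases b) (simp_all add: inv inv_word_def)
  qed
  have "braid w \<in> ?g" for w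
  proof (induction w)
    case Nil
    then show ?case using subgroup.one_closed [OF sub] by (simp add: one_B3)
  next
    case (Cons l w)
    obtain s b where "l = (s, b)" by force
    then show ?case
      using subgroup.m_closed [OF sub letter [of s b] Cons.IH] by (simp add: mult_B3)
  qed
  then have "carrier B3 \<subseteq> ?g" by (auto simp: carrier_B3)
  moreover have "braid_x \<otimes>\<^bsub>B3\<^esub> braid_x = braid_y \<otimes>\<^bsub>B3\<^esub> (braid_y \<otimes>\<^bsub>B3\<^esub> braid_y)"
  proof -
    have "braid_x \<otimes>\<^bsub>B3\<^esub> braid_x = braid_x \<otimes>\<^bsub>B3\<^esub> braid [(S2, True), (S1, True), (S2, True)]"
      by (simp only: rel)
    also have "\<dots> = braid_y \<otimes>\<^bsub>B3\<^esub> (braid_y \<otimes>\<^bsub>B3\<^esub> braid_y)"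
      by (simp add: mult_B3)
    finally show ?thesis .
  qed
  ultimately show ?thesis by unfold_locales (simp_all add: c)
qed

text \<open>The homomorphism is taken into the group of order automorphisms of the line, so that
  monotonicity of the action comes with it.\<close>

lemma trefoil_action_B3_exists:
  fixes n :: int
  assumes "0 \<le> n"
  shows "\<exists>\<rho>. trefoil_action B3 braid_x braid_y n \<rho>"
proof -
  let ?A = order_automorphisms
  define X where "X t = half_turn t + 18 * of_int n" for t
  define Y where "Y t = t + 2 + 12 * of_int n" for t :: real
  have XX: "X (X t) = t + 6 + 36 * of_int n" for t
    using half_turn_shift [of "half_turn t" "3 * n"]
    by (simp add: X_def half_turn_half_turn)
  have mono: "strict_mono X"
    using strict_mono_half_turn by (simp add: X_def strict_mono_def)
  have "X (X (t - 6 - 36 * of_int n)) = t" for t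
    by (simp add: XX)
  then have "bij X"
    using strict_mono_imp_inj_on [OF mono] by (intro bijI surjI) auto
  moreover note mono
  moreover have "bij Y"
    by (rule o_bij [of "\<lambda>t. t - 2 - 12 * of_int n"]) (simp_all add: fun_eq_iff Y_def)
  moreover have "strict_mono Y" by (simp add: Y_def strict_mono_def)
  moreover have "X \<circ> X = Y \<circ> (Y \<circ> Y)"
    by (simp add: fun_eq_iff XX) (simp add: Y_def)
  ultimately obtain h where h: "h \<in> hom B3 ?A" "h braid_x = X" "h braid_y = Y"
    using braid_hom_exists [OF group_order_automorphisms, of X Y]
    by (auto simp: order_automorphisms_def)
  have "trefoil_action B3 braid_x braid_y n h"
  proof (intro trefoil_action.intro trefoil_group_B3 trefoil_action_axioms.intro assms)
    fix f g t assume "f \<in> carrier B3" "g \<in> carrier B3"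
    then show "h (f \<otimes>\<^bsub>B3\<^esub> g) t = h f (h g t)"
      using hom_mult [OF h(1)] by (simp add: order_automorphisms_def)
  next
    fix g assume "g \<in> carrier B3"
    then show "strict_mono (h g)"
      using hom_in_carrier [OF h(1)] by (auto simp: order_automorphisms_def)
  qed (simp_all add: h X_def Y_def)
  then show ?thesis by (rule exI [of _ h])
qed

theorem theorem3:
  shows "\<exists>S. countable S \<and> infinite S \<and>
           (\<forall>r\<in>S. isolated_left_order B3 r) \<and>
           (\<forall>r\<in>S. \<forall>r'\<in>S. r \<noteq> r' \<longrightarrow> \<not> automorphic_image B3 r r')"
proof -
  interpret trefoil_group B3 braid_x braid_y by (rule trefoil_group_B3)
  have "\<forall>n::nat. \<exists>\<rho>. trefoil_action B3 braid_x braid_y (int n) \<rho>"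
    by (intro allI trefoil_action_B3_exists) simp
  then obtain \<rho> where \<rho>: "\<And>n::nat. trefoil_action B3 braid_x braid_y (int n) (\<rho> n)"
    by metis
  define r where "r n = trefoil_action.ord B3 (\<rho> n)" for n
  obtain M where M: "M \<in> hom B3 SL2Z" "M braid_x = (0, 1, -1, 0)" "M braid_y = (0, -1, 1, 1)"
    using braid_hom_exists [OF group_SL2Z, of "(0, 1, -1, 0)" "(0, -1, 1, 1)"] by auto
  have index: "m = n" if "automorphic_image B3 (r n) (r m)" for m n
  proof -
    interpret m: trefoil_action B3 braid_x braid_y "int m" "\<rho> m" by (rule \<rho>)
    interpret n: trefoil_action B3 braid_x braid_y "int n" "\<rho> n" by (rule \<rho>)
    from that obtain \<phi> where \<phi>: "\<phi> \<in> auto B3" "r m = pullback_order B3 \<phi> (r n)"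
      by (auto simp: automorphic_image_def)
    then have hom: "\<phi> \<in> hom B3 B3" and bij: "bij_betw \<phi> (carrier B3) (carrier B3)"
      by (auto simp: auto_def Bij_def)
    then have iso: "\<phi> \<in> iso B3 B3" by (simp add: iso_def)
    interpret \<phi>: group_hom B3 B3 \<phi> by unfold_locales (rule hom)
    have r_iff: "(f, g) \<in> m.ord \<longleftrightarrow> (\<phi> f, \<phi> g) \<in> n.ord" if "f \<in> carrier B3" "g \<in> carrier B3" for f g
      using \<phi>(2) that by (auto simp: r_def pullback_order_def)
    have image: "\<phi> (least_pos (int m)) = least_pos (int n)"
    proof (rule n.least_pos_unique)
      have "(\<one>\<^bsub>B3\<^esub>, least_pos (int m)) \<in> m.ord"
        using m.pos_least_pos by (simp add: m.ord_def)
      then show "(\<one>\<^bsub>B3\<^esub>, \<phi> (least_pos (int m))) \<in> n.ord"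
        by (simp add: r_iff)
      fix g assume g: "(\<one>\<^bsub>B3\<^esub>, g) \<in> n.ord"
      then have "g \<in> carrier B3" by (simp add: n.ord_def)
      then obtain h where h: "h \<in> carrier B3" "g = \<phi> h"
        using bij by (auto simp: bij_betw_def)
      then have "(\<one>\<^bsub>B3\<^esub>, h) \<in> m.ord" using g by (simp add: r_iff)
      then have "m.pos (least_pos (int m)) \<le> m.pos h"
        by (intro m.least_pos_least) (simp_all add: m.ord_def)
      then have "h = least_pos (int m) \<or> (least_pos (int m), h) \<in> m.ord"
        using m.pos_inj [of "least_pos (int m)" h] h by (auto simp: m.ord_def)
      then show "g = \<phi> (least_pos (int m)) \<or> (\<phi> (least_pos (int m)), g) \<in> n.ord"
        using h by (auto simp: r_iff)
    qed simp
    have "inv_into (carrier B3) \<phi> (least_pos (int n)) = least_pos (int m)"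
      using bij by (simp add: image [symmetric] bij_betw_def inv_into_f_f)
    from least_pos_root_dvd [OF M iso_set_sym [OF iso] this]
      least_pos_root_dvd [OF M iso image]
    have "6 * int n + 1 = 6 * int m + 1"
      by (intro zdvd_antisym_nonneg) simp_all
    then show ?thesis by simp
  qed
  \<comment> \<open>the identity automorphism makes distinctness of the orders a special case of the previous step\<close>
  have "inj r"
  proof (rule injI)
    fix m n assume eq: "r m = r n"
    interpret n: trefoil_action B3 braid_x braid_y "int n" "\<rho> n" by (rule \<rho>)
    have "r n = pullback_order B3 (\<lambda>g\<in>carrier B3. g) (r n)"
      by (auto simp: pullback_order_def r_def n.ord_def)
    then show "m = n"
      using eq id_in_auto by (intro index) (auto simp: automorphic_image_def)
  qed
  then have "infinite (range r)" by (simp add: finite_image_iff)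
  moreover have "isolated_left_order B3 (r n)" for n
    unfolding r_def using trefoil_action.isolated_ord [OF \<rho>] .
  ultimately show ?thesis
    using index by (intro exI [of _ "range r"]) auto
qed

end
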